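(* Let $F$ be a graph on $n$ vertices such that the $3$-graph $\mathcal{K}_3(F)$ of triangles of $F$ is linear. Then $$R_{\mathrm{ind}}^{\Delta}(F)\leq 2^{2^{2^{40n}}}.$$
   Context: All graphs are finite and simple. For a graph $F$, $\mathcal{K}_3(F)$ is the $3$-uniform hypergraph on vertex set $V(F)$ whose edges are the triples of vertices that form triangles in $F$. A $3$-uniform hypergraph is linear if any two distinct edges share at most one vertex. For graphs $G,F$, write $G\overset{\mathrm{ind}}{\rightarrow}(F)^{\Delta}$ if for every $2$-coloring of the triangles of $G$ there is an induced copy of $F$ in $G$ all of whose triangles have the same color. $R_{\mathrm{ind}}^{\Delta}(F)$ is the smallest integer $N$ such that there exists a graph $G$ on $N$ vertices with $G\overset{\mathrm{ind}}{\rightarrow}(F)^{\Delta}$. *)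

theory Defs
  imports "Graph_Theory.Graph_Theory" "HOL-Library.Extended_Nat"
begin

text \<open>Finite simple graphs are rendered by the locale predicate \<^const>\<open>pair_graph\<close>: a finite vertex
  set \<^const>\<open>pverts\<close> with a symmetric loop-free adjacency relation \<^const>\<open>parcs\<close> on it.\<close>

record 'a hypergraph =
  hverts :: "'a set"
  hedges :: "'a set set"

definition triangles :: "'a pair_pre_digraph \<Rightarrow> 'a set set" where
  "triangles G = {T. T \<subseteq> pverts G \<and> card T = 3 \<and> (\<forall>x\<in>T. \<forall>y\<in>T. x \<noteq> y \<longrightarrow> (x, y) \<in> parcs G)}"

definition K3 :: "'a pair_pre_digraph \<Rightarrow> 'a hypergraph" where
  "K3 G = \<lparr> hverts = pverts G, hedges = triangles G \<rparr>"

definition linear_3graph :: "'a hypergraph \<Rightarrow> bool" where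
  "linear_3graph H \<longleftrightarrow>
     (\<forall>e\<in>hedges H. e \<subseteq> hverts H \<and> card e = 3) \<and>
     (\<forall>e\<in>hedges H. \<forall>f\<in>hedges H. e \<noteq> f \<longrightarrow> card (e \<inter> f) \<le> 1)"

definition induced_copy :: "'b pair_pre_digraph \<Rightarrow> 'a pair_pre_digraph \<Rightarrow> 'b pair_pre_digraph \<Rightarrow> bool" where
  "induced_copy H F G \<longleftrightarrow>
     induced_subgraph (with_proj H) (with_proj G) \<and> digraph_iso (with_proj F) (with_proj H)"

text \<open>A coloring is a total function on vertex sets; only its values on triangles of \<open>G\<close> matter.\<close>

definition ind_arrow_triangles :: "'b pair_pre_digraph \<Rightarrow> 'a pair_pre_digraph \<Rightarrow> bool" where
  "ind_arrow_triangles G F \<longleftrightarrow>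
     (\<forall>c :: 'b set \<Rightarrow> bool. \<exists>H. induced_copy H F G \<and> (\<exists>b. \<forall>T\<in>triangles H. c T = b))"

text \<open>Every finite graph is isomorphic to one with vertices in \<^typ>\<open>nat\<close>, so ranging over those loses
  nothing. The value is \<open>\<infinity>\<close> if no \<open>G\<close> exists, so an upper bound includes existence.\<close>

definition R_ind_triangles :: "'a pair_pre_digraph \<Rightarrow> enat" where
  "R_ind_triangles F =
     Inf {enat N | N. \<exists>G :: nat pair_pre_digraph.
            pair_graph G \<and> card (pverts G) = N \<and> ind_arrow_triangles G F}"

end

theory Submission
  imports Defs "HOL-Analysis.Convex"
begin

text \<open>
  The host graph is the Hadamard graph on \<open>2 ^ K\<close> vertices: by Lindsey's lemma both its edges and its
  non-edges have density at least 1/4 between any two sets of size about \<open>2 ^ (K/2)\<close>, so triangles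
  are hereditarily dense too.

  Given a colouring, either red is hereditarily dense on a triple of vertex sets, or there are large
  subsets on which red is so sparse that blue is hereditarily dense. As in the Erdos--Rado proof,
  this is applied to \<open>V i\<close>, \<open>V j\<close> and one common set containing all later \<open>V k\<close>, so the dense colour
  of \<open>(V i, V j, V k)\<close> depends only on \<open>i < j\<close>. Only about \<open>16 ^ n\<close> steps are needed, after which
  Ramsey's theorem for pairs yields \<open>n\<close> sets all of whose triples are dense in one colour.

  The triangles of \<open>F\<close> and the pairs not contained in a triangle form a linear hypergraph covering each
  pair once. Hence, fixing all vertices outside one hyperedge, the remaining constraints confine
  the vertices of that hyperedge to a product set, where hereditary density applies. Removing the
  hyperedges one at a time bounds the number of induced copies of \<open>F\<close> from below.
\<close>

section \<open>Pseudorandomness of Hadamard graphs\<close>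

text \<open>An entry of the Sylvester-Hadamard matrix of order \<open>2 ^ k\<close>: -1 raised to
  the inner product of the last \<open>k\<close> binary digits of \<open>x\<close> and
  \<open>y\<close>.\<close>

fun sylvester :: "nat \<Rightarrow> nat \<Rightarrow> nat \<Rightarrow> int" where
  "sylvester 0 x y = 1"
| "sylvester (Suc k) x y = (if odd x \<and> odd y then - 1 else 1) * sylvester k (x div 2) (y div 2)"

lemma sylvester_commute: "sylvester k x y = sylvester k y x"
  by (induction k x y rule: sylvester.induct) auto

lemma sylvester_cases: "sylvester k x y = 1 \<or> sylvester k x y = - 1"
  by (induction k x y rule: sylvester.induct) auto

lemma sum_lessThan_double: "(\<Sum>x<2 * m. f x) = (\<Sum>x<m. f (2 * x) + f (2 * x + 1))"
  for f :: "nat \<Rightarrow> int"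
  by (induction m) (auto simp: algebra_simps)

text \<open>Splitting \<open>x\<close> by its last bit yields two copies, up to sign, of the sum for
  \<open>y div 2\<close> and \<open>z div 2\<close>. They cancel if the last bits of
  \<open>y\<close> and \<open>z\<close> differ; otherwise the halved indices still differ and
  induction applies.\<close>

lemma sylvester_orthogonal:
  assumes "y < 2 ^ k" "z < 2 ^ k" "y \<noteq> z"
  shows "(\<Sum>x<2 ^ k. sylvester k x y * sylvester k x z) = 0"
  using assms
proof (induction k arbitrary: y z)
  case (Suc k)
  let ?h = "\<lambda>y z. \<Sum>x<2 ^ k. sylvester k x (y div 2) * sylvester k x (z div 2)"
  have "(\<Sum>x<2 ^ Suc k. sylvester (Suc k) x y * sylvester (Suc k) x z)
      = (1 + (if odd y = odd z then 1 else - 1)) * ?h y z"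
    unfolding power_Suc sum_lessThan_double
    by (auto simp: sum_distrib_left sum_negf intro!: sum.cong)
  moreover have "?h y z = 0" if "odd y = odd z"
  proof (rule Suc.IH)
    show "y div 2 < 2 ^ k" "z div 2 < 2 ^ k" using Suc.prems by auto
    show "y div 2 \<noteq> z div 2" using Suc.prems(3) that
      by (metis bit_eq_rec)
  qed
  ultimately show ?case by auto
qed auto

text \<open>Cauchy-Schwarz over \<open>X\<close>, then the sum of squared row sums is enlarged to
  all \<open>2 ^ k\<close> rows. After expanding the square, orthogonality leaves only the diagonal
  terms.\<close>

lemma sylvester_lindsey:
  assumes X: "X \<subseteq> {..<2 ^ k}" and Y: "Y \<subseteq> {..<2 ^ k}"
  shows "(\<Sum>x\<in>X. \<Sum>y\<in>Y. sylvester k x y)\<^sup>2 \<le> int (card X) * int (card Y) * 2 ^ k"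
proof -
  have fin: "finite X" "finite Y" using X Y finite_subset by blast+
  let ?s = "\<lambda>x. \<Sum>y\<in>Y. sylvester k x y"
  have "(\<Sum>x\<in>X. ?s x)\<^sup>2 \<le> int (card X) * (\<Sum>x\<in>X. (?s x)\<^sup>2)"
  proof -
    have "real_of_int ((\<Sum>x\<in>X. ?s x)\<^sup>2) \<le> real_of_int (int (card X) * (\<Sum>x\<in>X. (?s x)\<^sup>2))"
      using sum_squared_le_sum_of_squares[of "\<lambda>x. real_of_int (?s x)" X] by (simp add: mult.commute)
    then show ?thesis by (simp only: of_int_le_iff)
  qed
  also have "\<dots> \<le> int (card X) * (\<Sum>x<2 ^ k. (?s x)\<^sup>2)"
    by (intro mult_left_mono sum_mono2) (use X in auto)
  also have "(\<Sum>x<2 ^ k. (?s x)\<^sup>2)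
      = (\<Sum>x<2 ^ k. \<Sum>y\<in>Y. \<Sum>z\<in>Y. sylvester k x y * sylvester k x z)"
    by (simp add: power2_eq_square sum_product)
  also have "\<dots> = (\<Sum>y\<in>Y. \<Sum>z\<in>Y. \<Sum>x<2 ^ k. sylvester k x y * sylvester k x z)"
    by (subst sum.swap, rule sum.cong[OF refl], rule sum.swap)
  also have "\<dots> = (\<Sum>y\<in>Y. \<Sum>z\<in>Y. if z = y then 2 ^ k else 0)"
  proof (intro sum.cong refl)
    fix y z assume yz: "y \<in> Y" "z \<in> Y"
    have "sylvester k x y * sylvester k x y = 1" for x
      using sylvester_cases[of k x y] by auto
    then show "(\<Sum>x<2 ^ k. sylvester k x y * sylvester k x z) = (if z = y then 2 ^ k else 0)"
      using sylvester_orthogonal[of y k z] yz Y by auto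
  qed
  also have "\<dots> = int (card Y) * 2 ^ k"
    using fin by simp
  finally show ?thesis by (simp add: mult.assoc)
qed

section \<open>Densities of edges and non-edges\<close>

definition count2 :: "('v \<Rightarrow> 'v \<Rightarrow> bool) \<Rightarrow> 'v set \<Rightarrow> 'v set \<Rightarrow> nat" where
  "count2 P X Y = (\<Sum>x\<in>X. \<Sum>y\<in>Y. of_bool (P x y))"

text \<open>Lindsey's bound makes the sign sum at most 1/8 of \<open>card X * card Y\<close> in
  absolute value, and twice the diagonal costs at most another 1/8, as the sets have at least 16
  elements. So at least 3/8 of all pairs qualify.\<close>

lemma count2_sylvester:
  assumes X: "X \<subseteq> {..<2 ^ k}" and Y: "Y \<subseteq> {..<2 ^ k}" and L: "k + 6 \<le> 2 * l" "4 \<le> l"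
    and cX: "2 ^ l \<le> card X" and cY: "2 ^ l \<le> card Y" and \<sigma>: "\<sigma> = 1 \<or> \<sigma> = - 1"
  shows "card X * card Y \<le> 4 * count2 (\<lambda>x y. x \<noteq> y \<and> sylvester k x y = \<sigma>) X Y"
proof -
  have fin: "finite X" "finite Y" using X Y finite_subset by blast+
  let ?S = "\<Sum>x\<in>X. \<Sum>y\<in>Y. sylvester k x y"
  let ?P = "\<lambda>x y. x \<noteq> y \<and> sylvester k x y = \<sigma>"
  define a where "a = int (card X)"
  define b where "b = int (card Y)"
  have ab: "a \<ge> 2 ^ l" "b \<ge> 2 ^ l" using cX cY unfolding a_def b_def by (simp_all add: of_nat_le_iff[symmetric] del: of_nat_le_iff)
  have "(2::int) ^ l \<ge> 2 ^ 4" using L(2) by (intro power_increasing) auto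
  then have b16: "b \<ge> 16" "a \<ge> 0" using ab by (simp_all add: a_def)
  \<comment> \<open>The 6 in the size hypothesis is spent here: 64 is the square of the 8 by which
    the sign sum has to be beaten.\<close>
  have L': "64 * 2 ^ k \<le> (2 ^ l * 2 ^ l :: int)"
    using power_increasing[OF L(1), of "2 :: int"] by (simp add: power_add mult_2)
  have "(2 ^ l * 2 ^ l :: int) \<le> a * b" using ab b16 by (intro mult_mono) auto
  then have "64 * 2 ^ k \<le> a * b" using L' by linarith
  then have "a * b * (64 * 2 ^ k) \<le> a * b * (a * b)"
    using b16 by (intro mult_left_mono) auto
  moreover have "?S\<^sup>2 \<le> a * b * 2 ^ k" using sylvester_lindsey[OF X Y] by (simp add: a_def b_def)
  ultimately have "(8 * ?S)\<^sup>2 \<le> (a * b)\<^sup>2" by (simp add: power2_eq_square)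
  then have "\<bar>8 * ?S\<bar> \<le> \<bar>a * b\<bar>" by (simp only: abs_le_square_iff)
  then have "\<bar>8 * ?S\<bar> \<le> a * b" using b16 by (simp add: abs_mult)
  then have S: "8 * (\<sigma> * ?S) \<ge> - (a * b)" using \<sigma> by auto
  \<comment> \<open>\<open>1 + \<sigma> * sylvester k x y\<close> is twice the indicator of the sign
    \<open>\<sigma>\<close>; the subtracted term discards the diagonal.\<close>
  have pt: "1 + \<sigma> * sylvester k x y - 2 * of_bool (x = y) \<le> 2 * of_bool (?P x y)" for x y
    using sylvester_cases[of k x y] \<sigma> by (cases "x = y") auto
  have "(\<Sum>x\<in>X. \<Sum>y\<in>Y. 1 + \<sigma> * sylvester k x y - 2 * of_bool (x = y))
     \<le> (\<Sum>x\<in>X. \<Sum>y\<in>Y. 2 * of_bool (?P x y))"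
    by (intro sum_mono pt)
  also have "\<dots> = 2 * int (count2 ?P X Y)"
    by (simp add: count2_def sum_distrib_left)
  also have "(\<Sum>x\<in>X. \<Sum>y\<in>Y. 1 + \<sigma> * sylvester k x y - 2 * of_bool (x = y))
      = a * b + \<sigma> * ?S - 2 * (\<Sum>x\<in>X. \<Sum>y\<in>Y. of_bool (x = y))"
    by (simp add: sum.distrib sum_subtractf a_def b_def sum_distrib_left)
  finally have 1: "a * b + \<sigma> * ?S - 2 * (\<Sum>x\<in>X. \<Sum>y\<in>Y. of_bool (x = y)) \<le> 2 * int (count2 ?P X Y)" .
  have "(\<Sum>y\<in>Y. of_bool (x = y)) \<le> (1::int)" for x
    using fin by (simp add: of_bool_def)
  then have "(\<Sum>x\<in>X. \<Sum>y\<in>Y. of_bool (x = y)) \<le> (\<Sum>x\<in>X. 1::int)"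
    by (intro sum_mono)
  then have 2: "(\<Sum>x\<in>X. \<Sum>y\<in>Y. of_bool (x = y)) \<le> a" by (simp add: a_def)
  have "a * 16 \<le> a * b" using b16 by (intro mult_left_mono) auto
  then have "a * b \<le> 4 * int (count2 ?P X Y)" using 1 2 S by linarith
  then have "int (card X * card Y) \<le> int (4 * count2 ?P X Y)" by (simp add: a_def b_def)
  then show ?thesis by (simp only: of_nat_le_iff)
qed

section \<open>Hereditarily dense triples\<close>

definition count3 :: "('v \<Rightarrow> 'v \<Rightarrow> 'v \<Rightarrow> bool) \<Rightarrow> 'v set \<Rightarrow> 'v set \<Rightarrow> 'v set \<Rightarrow> nat" where
  "count3 P X Y Z = (\<Sum>x\<in>X. \<Sum>y\<in>Y. \<Sum>z\<in>Z. of_bool (P x y z))"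

lemma count3_sum_snd: "count3 P X Y Z = (\<Sum>y\<in>Y. count2 (\<lambda>x z. P x y z) X Z)"
  unfolding count3_def count2_def by (rule sum.swap)

lemma count3_sum_trd: "count3 P X Y Z = (\<Sum>z\<in>Z. count2 (\<lambda>x y. P x y z) X Y)"
proof -
  have "count3 P X Y Z = (\<Sum>x\<in>X. \<Sum>z\<in>Z. \<Sum>y\<in>Y. of_bool (P x y z))"
    unfolding count3_def by (intro sum.cong refl sum.swap)
  also have "\<dots> = (\<Sum>z\<in>Z. \<Sum>x\<in>X. \<Sum>y\<in>Y. of_bool (P x y z))" by (rule sum.swap)
  finally show ?thesis unfolding count2_def .
qed

lemma count3_mono:
  assumes "finite X" "finite Y" "finite Z" "X' \<subseteq> X" "Y' \<subseteq> Y" "Z' \<subseteq> Z"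
  shows "count3 P X' Y' Z' \<le> count3 P X Y Z"
proof -
  have "count3 P X' Y' Z' \<le> (\<Sum>x\<in>X'. \<Sum>y\<in>Y. \<Sum>z\<in>Z. of_bool (P x y z))"
    unfolding count3_def
    by (intro sum_mono order_trans[OF sum_mono sum_mono2] sum_mono2 assms) auto
  also have "\<dots> \<le> count3 P X Y Z"
    unfolding count3_def by (intro sum_mono2 assms) auto
  finally show ?thesis .
qed

text \<open>Deleting an element with \<open>B \<le> M * f x\<close> keeps the average below the
  bound; once no such element is left, any \<open>s\<close> elements do. The multiplier
  \<open>M\<close> avoids division.\<close>

lemma exists_subset_sum_less:
  fixes f :: "'v \<Rightarrow> nat"
  assumes "finite X" "s \<le> card X" "0 < s" "M * sum f X < card X * B"
  shows "\<exists>X'\<subseteq>X. card X' = s \<and> M * sum f X' < s * B"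
  using assms
proof (induction X rule: finite_psubset_induct)
  case (psubset X)
  consider "card X = s" | x where "s < card X" "x \<in> X" "B \<le> M * f x"
    | "s < card X" "\<And>x. x \<in> X \<Longrightarrow> M * f x < B"
    using psubset.prems(1) by (meson le_neq_implies_less not_le)
  then show ?case
  proof cases
    case 1
    then show ?thesis using psubset.prems by auto
  next
    case (2 x)
    have "sum f X = f x + sum f (X - {x})" using 2 psubset.hyps by (simp add: sum.remove)
    moreover have "card X = Suc (card (X - {x}))"
      using 2 psubset.hyps by (metis card_Suc_Diff1)
    ultimately have "s \<le> card (X - {x})" "M * sum f (X - {x}) < card (X - {x}) * B"
      using psubset.prems 2 by (auto simp: algebra_simps)
    then obtain X' where "X' \<subseteq> X - {x}" "card X' = s" "M * sum f X' < s * B"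
      using psubset.IH[of "X - {x}"] 2 psubset.prems by blast
    then show ?thesis by blast
  next
    case 3
    obtain X' where X': "X' \<subseteq> X" "card X' = s" "finite X'"
      using obtain_subset_with_card_n[OF psubset.prems(1)] by metis
    have "M * sum f X' = (\<Sum>x\<in>X'. M * f x)" by (simp add: sum_distrib_left)
    also have "\<dots> < (\<Sum>x\<in>X'. B)"
      using X' 3 psubset.prems by (intro sum_strict_mono) auto
    finally show ?thesis using X' by auto
  qed
qed

text \<open>The averaging lemma is applied to one coordinate at a time, with the other two summed
  out. It trims a sparse triple to parts of a prescribed size while keeping the density
  bound.\<close>

lemma exists_subsets_count3_less:
  assumes fin: "finite X" "finite Y" "finite Z"
    and s: "0 < s" "s \<le> card X" "s \<le> card Y" "s \<le> card Z"
    and less: "M * count3 P X Y Z < card X * card Y * card Z"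
  obtains X' Y' Z' where "X' \<subseteq> X" "Y' \<subseteq> Y" "Z' \<subseteq> Z"
    "card X' = s" "card Y' = s" "card Z' = s" "M * count3 P X' Y' Z' < s * s * s"
proof -
  obtain X' where X': "X' \<subseteq> X" "card X' = s" "M * count3 P X' Y Z < s * (card Y * card Z)"
    using exists_subset_sum_less[OF fin(1) s(2,1), of M "\<lambda>x. count2 (P x) Y Z" "card Y * card Z"] less
    unfolding count3_def count2_def by (auto simp: mult.assoc)
  obtain Y' where Y': "Y' \<subseteq> Y" "card Y' = s" "M * count3 P X' Y' Z < s * (s * card Z)"
    using exists_subset_sum_less[OF fin(2) s(3,1), of M "\<lambda>y. count2 (\<lambda>x z. P x y z) X' Z" "s * card Z"] X'(3)
    unfolding count3_sum_snd by (auto simp: mult.left_commute)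
  obtain Z' where Z': "Z' \<subseteq> Z" "card Z' = s" "M * count3 P X' Y' Z' < s * (s * s)"
    using exists_subset_sum_less[OF fin(3) s(4,1), of M "\<lambda>z. count2 (\<lambda>x y. P x y z) X' Y'" "s * s"] Y'(3)
    unfolding count3_sum_trd by (auto simp: ac_simps)
  show thesis using that[of X' Y' Z'] X' Y' Z' by (simp add: mult.assoc)
qed

text \<open>Fewer than \<open>2 ^ l\<close> vertices of \<open>X\<close> see less than a quarter of
  \<open>Y\<close>, since together they would contradict the density hypothesis; likewise for
  \<open>Z\<close>. At least half of \<open>X\<close> remains, and the neighbourhoods of such a
  vertex still have \<open>2 ^ l\<close> elements, so the hypothesis applies between them. The
  factor is 2 * 4 * 4 * 4.\<close>

lemma triangle_count:
  assumes A: "\<And>X Y. X \<subseteq> \<Omega> \<Longrightarrow> Y \<subseteq> \<Omega> \<Longrightarrow> 2 ^ l \<le> card X \<Longrightarrow> 2 ^ l \<le> card Y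
      \<Longrightarrow> card X * card Y \<le> 4 * count2 A X Y"
    and fin: "finite \<Omega>" and sub: "X \<subseteq> \<Omega>" "Y \<subseteq> \<Omega>" "Z \<subseteq> \<Omega>"
    and large: "2 ^ (l + 2) \<le> card X" "2 ^ (l + 2) \<le> card Y" "2 ^ (l + 2) \<le> card Z"
  shows "card X * card Y * card Z \<le> 2 ^ 7 * count3 (\<lambda>x y z. A x y \<and> A x z \<and> A y z) X Y Z"
proof -
  have finX: "finite X" "finite Y" "finite Z" using sub fin finite_subset by blast+
  define N where "N W x = {y \<in> W. A x y}" for W x
  define Bad where "Bad W = {x \<in> X. 4 * card (N W x) < card W}" for W
  have Bad: "card (Bad W) < 2 ^ l" if W: "W \<subseteq> \<Omega>" "2 ^ (l + 2) \<le> card W" for W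
  proof (rule ccontr)
    assume "\<not> card (Bad W) < 2 ^ l"
    then have large: "2 ^ l \<le> card (Bad W)" by simp
    have finW: "finite W" using W fin finite_subset by blast
    have "Bad W \<noteq> {}" using large by (metis card.empty le_zero_eq power_not_zero zero_neq_numeral)
    have "(2::nat) ^ l \<le> 2 ^ (l + 2)" by simp
    then have "2 ^ l \<le> card W" using W(2) by linarith
    then have "card (Bad W) * card W \<le> 4 * count2 A (Bad W) W"
      using A[of "Bad W" W] large W sub by (auto simp: Bad_def)
    also have "\<dots> = (\<Sum>x\<in>Bad W. 4 * card (N W x))"
      unfolding count2_def N_def using finW by (simp add: sum_distrib_left Int_def)
    also have "\<dots> < (\<Sum>x\<in>Bad W. card W)"
      using \<open>Bad W \<noteq> {}\<close> finX by (intro sum_strict_mono) (auto simp: Bad_def)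
    finally show False by simp
  qed
  define Good where "Good = X - (Bad Y \<union> Bad Z)"
  have "card X - card (Bad Y \<union> Bad Z) \<le> card Good"
    unfolding Good_def by (rule diff_card_le_card_Diff) (use finX in \<open>auto simp: Bad_def\<close>)
  moreover have "card (Bad Y \<union> Bad Z) \<le> card (Bad Y) + card (Bad Z)" by (rule card_Un_le)
  ultimately have half: "card X \<le> 2 * card Good"
    using Bad[OF sub(2) large(2)] Bad[OF sub(3) large(3)] large(1) by simp
  have row: "card Y * card Z \<le> 64 * count2 (\<lambda>y z. A x y \<and> A x z \<and> A y z) Y Z" if "x \<in> Good" for x
  proof -
    have x: "card Y \<le> 4 * card (N Y x)" "card Z \<le> 4 * card (N Z x)"
      using that by (auto simp: Good_def Bad_def not_less)
    then have "card Y * card Z \<le> (4 * card (N Y x)) * (4 * card (N Z x))" by (intro mult_mono) auto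
    also have "\<dots> = 16 * (card (N Y x) * card (N Z x))" by simp
    also have "card (N Y x) * card (N Z x) \<le> 4 * count2 A (N Y x) (N Z x)"
      using A[of "N Y x" "N Z x"] x large sub by (auto simp: N_def)
    also have "count2 A (N Y x) (N Z x) = count2 (\<lambda>y z. A x y \<and> A x z \<and> A y z) Y Z"
    proof -
      have "(\<Sum>z\<in>N Z x. of_bool (A y z)) = (\<Sum>z\<in>Z. if A x z then of_bool (A y z) else 0 :: nat)" for y
        unfolding N_def by (rule sum.inter_filter[OF finX(3)])
      then have "count2 A (N Y x) (N Z x)
          = (\<Sum>y\<in>Y. if A x y then \<Sum>z\<in>Z. if A x z then of_bool (A y z) else 0 else 0)"
        unfolding count2_def N_def[of Y] by (simp only: sum.inter_filter[OF finX(2)])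
      also have "\<dots> = count2 (\<lambda>y z. A x y \<and> A x z \<and> A y z) Y Z"
        unfolding count2_def by (rule sum.cong[OF refl]) (auto intro!: sum.cong simp del: sum_of_bool_eq)
      finally show ?thesis .
    qed
    finally show ?thesis by simp
  qed
  have "card X * card Y * card Z \<le> 2 * (card Good * (card Y * card Z))"
    using mult_right_mono[OF half, of "card Y * card Z"] by (simp only: mult.assoc)
  also have "card Good * (card Y * card Z)
     \<le> (\<Sum>x\<in>Good. 64 * count2 (\<lambda>y z. A x y \<and> A x z \<and> A y z) Y Z)"
    using sum_mono[OF row, of Good "\<lambda>x. x"] by simp
  also have "\<dots> \<le> (\<Sum>x\<in>X. 64 * count2 (\<lambda>y z. A x y \<and> A x z \<and> A y z) Y Z)"
    using finX by (intro sum_mono2) (auto simp: Good_def)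
  also have "\<dots> = 64 * count3 (\<lambda>x y z. A x y \<and> A x z \<and> A y z) X Y Z"
    unfolding count3_def count2_def by (simp add: sum_distrib_left)
  finally show ?thesis by simp
qed

text \<open>The threshold \<open>s\<close> is an absolute size rather than a proportion, so the
  property passes to subsets with the same parameters.\<close>

definition dense3 :: "('v \<Rightarrow> 'v \<Rightarrow> 'v \<Rightarrow> bool) \<Rightarrow> nat \<Rightarrow> nat \<Rightarrow> 'v set \<Rightarrow> 'v set \<Rightarrow> 'v set \<Rightarrow> bool" where
  "dense3 P s d A B C \<longleftrightarrow> (\<forall>X\<subseteq>A. \<forall>Y\<subseteq>B. \<forall>Z\<subseteq>C. s \<le> card X \<longrightarrow> s \<le> card Y \<longrightarrow> s \<le> card Z
     \<longrightarrow> card X * card Y * card Z \<le> 2 ^ d * count3 P X Y Z)"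

lemma dense3_subset:
  "dense3 P s d A B C \<Longrightarrow> A' \<subseteq> A \<Longrightarrow> B' \<subseteq> B \<Longrightarrow> C' \<subseteq> C \<Longrightarrow> dense3 P s d A' B' C'"
  unfolding dense3_def by (meson order_trans)

text \<open>A violation for \<open>P\<close> can be trimmed to three sets of size exactly
  \<open>2 ^ (w + u)\<close>. Passing to subsets of size at least \<open>2 ^ w\<close> raises the
  density of \<open>P\<close> by a factor of at most \<open>2 ^ (3 * u)\<close>, so it stays below
  1/256, half of the guaranteed total 1/128. The other half belongs to \<open>Q\<close>.\<close>

lemma dense3_dichotomy:
  assumes fin: "finite A" "finite B" "finite C"
    and total: "\<And>X Y Z. X \<subseteq> A \<Longrightarrow> Y \<subseteq> B \<Longrightarrow> Z \<subseteq> C \<Longrightarrow> 2 ^ w \<le> card X \<Longrightarrow> 2 ^ w \<le> card Y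
      \<Longrightarrow> 2 ^ w \<le> card Z \<Longrightarrow> card X * card Y * card Z \<le> 2 ^ 7 * (count3 P X Y Z + count3 Q X Y Z)"
  obtains "dense3 P (2 ^ (w + u)) (3 * u + 8) A B C"
  | X Y Z where "X \<subseteq> A" "Y \<subseteq> B" "Z \<subseteq> C" "card X = 2 ^ (w + u)" "card Y = 2 ^ (w + u)"
      "card Z = 2 ^ (w + u)" "dense3 Q (2 ^ w) 8 X Y Z"
proof (cases "dense3 P (2 ^ (w + u)) (3 * u + 8) A B C")
  case True
  then show thesis by (rule that)
next
  case False
  let ?s = "2 ^ (w + u) :: nat"
  from False obtain X1 Y1 Z1 where 1: "X1 \<subseteq> A" "Y1 \<subseteq> B" "Z1 \<subseteq> C" "?s \<le> card X1" "?s \<le> card Y1"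
    "?s \<le> card Z1" "2 ^ (3 * u + 8) * count3 P X1 Y1 Z1 < card X1 * card Y1 * card Z1"
    unfolding dense3_def by (auto simp: not_le)
  have "finite X1" "finite Y1" "finite Z1" using 1 fin finite_subset by blast+
  then obtain X Y Z where 2: "X \<subseteq> X1" "Y \<subseteq> Y1" "Z \<subseteq> Z1" "card X = ?s" "card Y = ?s" "card Z = ?s"
    and few: "2 ^ (3 * u + 8) * count3 P X Y Z < ?s * ?s * ?s"
    using exists_subsets_count3_less[of X1 Y1 Z1 ?s] 1 by (metis zero_less_numeral zero_less_power)
  \<comment> \<open>This bounds an absolute count, hence it is inherited by all subsets.\<close>
  have few': "2 ^ 8 * count3 P X Y Z < 2 ^ w * 2 ^ w * 2 ^ w"
  proof -
    have "2 ^ (3 * u) * (2 ^ w * 2 ^ w * 2 ^ w) = ?s * ?s * ?s"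
      unfolding power_add[symmetric] by (rule arg_cong[of _ _ "power 2"]) simp
    then have "2 ^ (3 * u) * (2 ^ 8 * count3 P X Y Z) < 2 ^ (3 * u) * (2 ^ w * 2 ^ w * 2 ^ w)"
      using few by (simp only: power_add mult.assoc)
    then show ?thesis by simp
  qed
  have fin2: "finite X" "finite Y" "finite Z" using 2 by (metis card.infinite power_not_zero zero_neq_numeral)+
  have "dense3 Q (2 ^ w) 8 X Y Z"
    unfolding dense3_def
  proof (intro allI impI)
    fix X' Y' Z' assume 3: "X' \<subseteq> X" "Y' \<subseteq> Y" "Z' \<subseteq> Z"
      "2 ^ w \<le> card X'" "2 ^ w \<le> card Y'" "2 ^ w \<le> card Z'"
    have "2 ^ 8 * count3 P X' Y' Z' \<le> 2 ^ 8 * count3 P X Y Z"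
      using count3_mono[OF fin2 3(1-3)] by simp
    also have "\<dots> < 2 ^ w * 2 ^ w * 2 ^ w" by (rule few')
    also have "\<dots> \<le> card X' * card Y' * card Z'" using 3 by (intro mult_mono) auto
    finally have "2 ^ 8 * count3 P X' Y' Z' \<le> card X' * card Y' * card Z'" by simp
    moreover have "card X' * card Y' * card Z' \<le> 2 ^ 7 * (count3 P X' Y' Z' + count3 Q X' Y' Z')"
      by (rule total) (use 1 2 3 in auto)
    ultimately show "card X' * card Y' * card Z' \<le> 2 ^ 8 * count3 Q X' Y' Z'" by simp
  qed
  then show thesis using that(2)[of X Y Z] 1 2 by blast
qed

section \<open>Dense sequences of vertex sets\<close>

text \<open>All sets in the sequence below have size \<open>2 ^ p\<close>, and \<open>shrinkage E r\<close> bounds the loss in \<open>p\<close> over the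
  remaining \<open>r\<close> steps. The threshold of a step has to stay below the final size by a factor
  \<open>2 ^ (E * (d + 1))\<close>, where \<open>2 ^ -d\<close> is the density obtained in that step; \<open>d\<close> only depends on the losses in
  later steps, so there is no circularity.\<close>

fun shrinkage :: "nat \<Rightarrow> nat \<Rightarrow> nat" where
  "shrinkage E 0 = 0"
| "shrinkage E (Suc r) = 2 * shrinkage E r + E * (3 * (shrinkage E r + 9 * E) + 9)"

text \<open>The power \<open>(50 * E) ^ (r + 1)\<close> dominates \<open>shrinkage E r\<close>,
  \<open>E\<close> and 1. Replacing all three by it, one step costs a factor of at most
  \<open>2 + 39 * E\<close>, which is below \<open>50 * E\<close>.\<close>

lemma shrinkage_le:
  assumes "1 \<le> E"
  shows "shrinkage E r \<le> (50 * E) ^ (r + 1)"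
proof (induction r)
  case (Suc r)
  have "1 \<le> (50 * E) ^ r" using assms by simp
  then have one: "E \<le> (50 * E) ^ (r + 1)" using assms mult_le_mono[of E "50 * E" 1 "(50 * E) ^ r"] by simp
  have "shrinkage E (Suc r) \<le> 2 * (50 * E) ^ (r + 1) + E * (3 * ((50 * E) ^ (r + 1) + 9 * (50 * E) ^ (r + 1)) + 9 * (50 * E) ^ (r + 1))"
    unfolding shrinkage.simps
    using assms one Suc.IH by (intro add_mono mult_mono order_refl) auto
  also have "\<dots> = (2 + 39 * E) * (50 * E) ^ (r + 1)" by (simp add: algebra_simps)
  also have "\<dots> \<le> (50 * E) * (50 * E) ^ (r + 1)" using assms by (intro mult_right_mono) auto
  finally show ?case by simp
qed auto

lemma pair_index_eq:
  fixes m :: nat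
  assumes "j * m + i = j' * m + i'" "i < m" "i' < m"
  shows "i = i' \<and> j = j'"
  using assms by (metis add.commute div_mult_self1 div_less mod_less mod_mult_self1 add_0 gr_implies_not0)

text \<open>Step \<open>t\<close> treats the pair \<open>(t mod m, t div m)\<close>; the sets with index above \<open>t div m\<close> still coincide.
  The sets need not be disjoint, since the counted triples consist of distinct vertices anyway.\<close>

lemma homogeneous_dense_sequence:
  fixes P :: "bool \<Rightarrow> 'v \<Rightarrow> 'v \<Rightarrow> 'v \<Rightarrow> bool" and V :: "nat \<Rightarrow> 'v set"
  assumes fin: "finite \<Omega>"
    and total: "\<And>X Y Z. X \<subseteq> \<Omega> \<Longrightarrow> Y \<subseteq> \<Omega> \<Longrightarrow> Z \<subseteq> \<Omega> \<Longrightarrow> 2 ^ w \<le> card X \<Longrightarrow> 2 ^ w \<le> card Y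
      \<Longrightarrow> 2 ^ w \<le> card Z \<Longrightarrow> card X * card Y * card Z \<le> 2 ^ 7 * (count3 (P True) X Y Z + count3 (P False) X Y Z)"
    and "r + t = m * m" "\<And>k. V k \<subseteq> \<Omega>" "\<And>k. card (V k) = 2 ^ p"
    and "2 * shrinkage E r + w + 9 * E \<le> p"
    and "\<And>k. t div m < k \<Longrightarrow> V k = V (Suc (t div m))"
  shows "\<exists>V' c q. p \<le> q + shrinkage E r \<and> (\<forall>k. V' k \<subseteq> V k \<and> card (V' k) = 2 ^ q) \<and>
    (\<forall>i j k. i < j \<longrightarrow> j < k \<longrightarrow> j < m \<longrightarrow> t \<le> j * m + i \<longrightarrow>
      (\<exists>d s. dense3 (P (c i j)) s d (V' i) (V' j) (V' k) \<and> s * 2 ^ (E * (d + 1)) \<le> 2 ^ q))"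
  using assms(3-)
proof (induction r arbitrary: t V p)
  case 0
  \<comment> \<open>With no steps left, \<open>t = m * m\<close> exceeds the index of every relevant
    pair, so any colouring will do.\<close>
  have "\<not> t \<le> j * m + i" if "i < j" "j < m" for i j
  proof -
    have "j * m + i < Suc j * m" using that by simp
    also have "\<dots> \<le> m * m" using that by (intro mult_le_mono1) simp
    finally show ?thesis using 0 by simp
  qed
  then have "\<forall>i j k. i < j \<longrightarrow> j < k \<longrightarrow> j < m \<longrightarrow> t \<le> j * m + i \<longrightarrow>
      (\<exists>d s. dense3 (P ((\<lambda>_ _. True) i j)) s d (V i) (V j) (V k) \<and> s * 2 ^ (E * (d + 1)) \<le> 2 ^ p)"
    by blast
  then show ?case using 0 by (intro exI[of _ V] exI[of _ "\<lambda>_ _. True"] exI[of _ p]) auto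
next
  case (Suc r)
  define i where "i = t mod m"
  define j where "j = t div m"
  have "0 < m" using Suc.prems(1) by (cases m) auto
  have t: "t = j * m + i" and "i < m" using \<open>0 < m\<close> unfolding i_def j_def by auto
  have r: "r + Suc t = m * m" using Suc.prems(1) by simp
  \<comment> \<open>Since \<open>Suc t div m\<close> is at least \<open>j\<close>, sets that
    coincide beyond \<open>j\<close> satisfy the invariant of the next step.\<close>
  have eq: "U k = U (Suc (Suc t div m))" if "\<And>k. j < k \<Longrightarrow> U k = U (Suc j)" "Suc t div m < k"
    for U :: "nat \<Rightarrow> 'v set" and k
  proof -
    have "j \<le> Suc t div m" unfolding j_def by (rule div_le_mono) simp
    then show ?thesis using that(1)[of k] that(1)[of "Suc (Suc t div m)"] that(2) by simp
  qed
  have VS: "V k = V (Suc j)" if "j < k" for k using Suc.prems(5)[of k] that unfolding j_def by blast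
  have IH: "\<exists>V' c q. p' \<le> q + shrinkage E r \<and> (\<forall>k. V' k \<subseteq> U k \<and> card (V' k) = 2 ^ q) \<and>
      (\<forall>i j k. i < j \<longrightarrow> j < k \<longrightarrow> j < m \<longrightarrow> Suc t \<le> j * m + i \<longrightarrow>
        (\<exists>d s. dense3 (P (c i j)) s d (V' i) (V' j) (V' k) \<and> s * 2 ^ (E * (d + 1)) \<le> 2 ^ q))"
    if "\<And>k. U k \<subseteq> \<Omega>" "\<And>k. card (U k) = 2 ^ p'" "2 * shrinkage E r + w + 9 * E \<le> p'"
      "\<And>k. j < k \<Longrightarrow> U k = U (Suc j)" for U p'
    by (rule Suc.IH[OF r that(1,2,3)]) (rule eq[of U, OF that(4)])
  \<comment> \<open>Room for the blue case: after the later losses, a factor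
    \<open>2 ^ (9 * E)\<close> still separates the sets from the threshold, as density exponent 8
    demands.\<close>
  define u where "u = shrinkage E r + 9 * E"
  \<comment> \<open>Room for the red case, whose density exponent is
    \<open>3 * u + 8\<close>.\<close>
  define k where "k = shrinkage E r + E * (3 * u + 9)"
  have g: "shrinkage E (Suc r) = shrinkage E r + k" by (simp add: k_def u_def)
  show ?case
  proof (cases "i < j")
    \<comment> \<open>A pair with \<open>j \<le> i\<close> imposes no condition, so the sets are
      handed on unchanged.\<close>
    case False
    have "2 * shrinkage E r + w + 9 * E \<le> p" using Suc.prems(4) g by simp
    then obtain V' c q where q: "p \<le> q + shrinkage E r" "\<forall>k. V' k \<subseteq> V k \<and> card (V' k) = 2 ^ q"
      and dense: "\<forall>i j k. i < j \<longrightarrow> j < k \<longrightarrow> j < m \<longrightarrow> Suc t \<le> j * m + i \<longrightarrow>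
        (\<exists>d s. dense3 (P (c i j)) s d (V' i) (V' j) (V' k) \<and> s * 2 ^ (E * (d + 1)) \<le> 2 ^ q)"
      using IH[of V p, OF Suc.prems(2,3)] VS by blast
    have "Suc t \<le> j' * m + i'" if "i' < j'" "j' < m" "t \<le> j' * m + i'" for i' j'
    proof -
      have "t \<noteq> j' * m + i'"
        using pair_index_eq[of j m i j' i'] t \<open>i < m\<close> that False by auto
      then show ?thesis using that by simp
    qed
    then show ?thesis using q dense g
      by (intro exI[of _ V'] exI[of _ c] exI[of _ q] conjI) (simp, blast, blast)
  next
    case True
    \<comment> \<open>Red will have threshold \<open>2 ^ (w' + u)\<close> in sets of size
      \<open>2 ^ p\<close>, blue threshold \<open>2 ^ w'\<close> in sets of size
      \<open>2 ^ (w' + u)\<close>.\<close>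
    define w' where "w' = p - k - u"
    have p: "p = w' + u + k" "w \<le> w'"
      using Suc.prems(4) unfolding g w'_def u_def by auto
    have w: "(2::nat) ^ w \<le> 2 ^ w'" using p by simp
    have finV: "finite (V l)" for l using Suc.prems(2) fin finite_subset by blast
    have later: "Suc t \<le> j' * m + i'" if "i' < j'" "j' < m" "t \<le> j' * m + i'" "(i', j') \<noteq> (i, j)" for i' j'
    proof -
      have "t \<noteq> j' * m + i'"
        using pair_index_eq[of j m i j' i'] t \<open>i < m\<close> that by auto
      then show ?thesis using that by simp
    qed
    \<comment> \<open>Both colours end alike: the recursive call settles the later pairs, and the
      colour of \<open>(i, j)\<close> overrides its colouring at that pair.\<close>
    have finish: ?thesis
      if q: "p \<le> q + shrinkage E (Suc r)" "\<forall>k. V' k \<subseteq> V k \<and> card (V' k) = 2 ^ q"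
        and dense: "\<forall>i j k. i < j \<longrightarrow> j < k \<longrightarrow> j < m \<longrightarrow> Suc t \<le> j * m + i \<longrightarrow>
          (\<exists>d s. dense3 (P (c i j)) s d (V' i) (V' j) (V' k) \<and> s * 2 ^ (E * (d + 1)) \<le> 2 ^ q)"
        and new: "\<And>l. j < l \<Longrightarrow> dense3 (P b) s d (V' i) (V' j) (V' l)" "s * 2 ^ (E * (d + 1)) \<le> 2 ^ q"
      for V' q c b s d
    proof -
      let ?c = "\<lambda>i' j'. if (i', j') = (i, j) then b else c i' j'"
      have "\<exists>d s. dense3 (P (?c i' j')) s d (V' i') (V' j') (V' l) \<and> s * 2 ^ (E * (d + 1)) \<le> 2 ^ q"
        if "i' < j'" "j' < l" "j' < m" "t \<le> j' * m + i'" for i' j' l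
      proof (cases "(i', j') = (i, j)")
        case True
        then show ?thesis using new that by auto
      next
        case False
        then show ?thesis using dense later[OF that(1,3,4) False] that by auto
      qed
      then show ?thesis using q by (intro exI[of _ V'] exI[of _ ?c] exI[of _ q]) blast
    qed
    have tot: "card X * card Y * card Z \<le> 2 ^ 7 * (count3 (P True) X Y Z + count3 (P False) X Y Z)"
      if "X \<subseteq> V i" "Y \<subseteq> V j" "Z \<subseteq> V (Suc j)" "2 ^ w' \<le> card X" "2 ^ w' \<le> card Y" "2 ^ w' \<le> card Z" for X Y Z
    proof (rule total)
      show "X \<subseteq> \<Omega>" "Y \<subseteq> \<Omega>" "Z \<subseteq> \<Omega>" using that(1-3) Suc.prems(2) by blast+
      show "2 ^ w \<le> card X" "2 ^ w \<le> card Y" "2 ^ w \<le> card Z"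
        using that(4-6) w by linarith+
    qed
    consider (red) "dense3 (P True) (2 ^ (w' + u)) (3 * u + 8) (V i) (V j) (V (Suc j))"
      | (blue) X Y Z where "X \<subseteq> V i" "Y \<subseteq> V j" "Z \<subseteq> V (Suc j)" "card X = 2 ^ (w' + u)"
        "card Y = 2 ^ (w' + u)" "card Z = 2 ^ (w' + u)" "dense3 (P False) (2 ^ w') 8 X Y Z"
    proof (rule dense3_dichotomy[of "V i" "V j" "V (Suc j)" w' "P True" "P False" u])
      fix X Y Z assume "X \<subseteq> V i" "Y \<subseteq> V j" "Z \<subseteq> V (Suc j)" "2 ^ w' \<le> card X" "2 ^ w' \<le> card Y" "2 ^ w' \<le> card Z"
      then show "card X * card Y * card Z \<le> 2 ^ 7 * (count3 (P True) X Y Z + count3 (P False) X Y Z)"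
        by (rule tot)
    qed (rule finV | blast)+
    then show ?thesis
    proof cases
      case red
      have "2 * shrinkage E r + w + 9 * E \<le> p" using Suc.prems(4) g by simp
      then obtain V' c q where q: "p \<le> q + shrinkage E r" "\<forall>k. V' k \<subseteq> V k \<and> card (V' k) = 2 ^ q"
        and dense: "\<forall>i j k. i < j \<longrightarrow> j < k \<longrightarrow> j < m \<longrightarrow> Suc t \<le> j * m + i \<longrightarrow>
          (\<exists>d s. dense3 (P (c i j)) s d (V' i) (V' j) (V' k) \<and> s * 2 ^ (E * (d + 1)) \<le> 2 ^ q)"
        using IH[of V p, OF Suc.prems(2,3)] VS by blast
      have "w' + u + E * (3 * u + 8 + 1) \<le> q" using q(1) p(1) unfolding k_def by (simp add: algebra_simps)
      then have size: "2 ^ (w' + u) * 2 ^ (E * (3 * u + 8 + 1)) \<le> (2::nat) ^ q"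
        unfolding power_add[symmetric] by (intro power_increasing) auto
      have new: "dense3 (P True) (2 ^ (w' + u)) (3 * u + 8) (V' i) (V' j) (V' l)" if "j < l" for l
        using q(2) VS[OF that]
        by (intro dense3_subset[OF red]) auto
      have le: "p \<le> q + shrinkage E (Suc r)" using q(1) unfolding g by simp
      show ?thesis using finish[OF le q(2) dense new size] .
    next
      case blue
      \<comment> \<open>\<open>W\<close> only trims the sets at the remaining indices to the common
        size.\<close>
      define W where "W l = (SOME S. S \<subseteq> V l \<and> card S = 2 ^ (w' + u))" for l
      have W: "W l \<subseteq> V l \<and> card (W l) = 2 ^ (w' + u)" for l
      proof -
        have "(2::nat) ^ (w' + u) \<le> 2 ^ p" using p(1) by (intro power_increasing) auto
        then have "\<exists>S. S \<subseteq> V l \<and> card S = 2 ^ (w' + u)"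
          using obtain_subset_with_card_n[of "2 ^ (w' + u)" "V l"] Suc.prems(3) by metis
        then show ?thesis unfolding W_def by (rule someI_ex)
      qed
      \<comment> \<open>One \<open>Z\<close> replaces all later sets, so they still coincide and the
        density of \<open>(X, Y, Z)\<close> covers every later third index.\<close>
      define V1 where "V1 l = (if l = i then X else if l = j then Y else if j < l then Z else W l)" for l
      have V1V: "V1 l \<subseteq> V l" and cV1: "card (V1 l) = 2 ^ (w' + u)" for l
        using blue W[of l] VS[of l] unfolding V1_def by auto
      have V1\<Omega>: "V1 l \<subseteq> \<Omega>" for l using V1V Suc.prems(2) by blast
      have "2 * shrinkage E r + w + 9 * E \<le> w' + u" using Suc.prems(4) p(1) unfolding g by simp
      moreover have "V1 l = V1 (Suc j)" if "j < l" for l using that True unfolding V1_def by auto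
      ultimately obtain V' c q where q: "w' + u \<le> q + shrinkage E r" "\<forall>k. V' k \<subseteq> V1 k \<and> card (V' k) = 2 ^ q"
        and dense: "\<forall>i j k. i < j \<longrightarrow> j < k \<longrightarrow> j < m \<longrightarrow> Suc t \<le> j * m + i \<longrightarrow>
          (\<exists>d s. dense3 (P (c i j)) s d (V' i) (V' j) (V' k) \<and> s * 2 ^ (E * (d + 1)) \<le> 2 ^ q)"
        using IH[of V1 "w' + u", OF V1\<Omega> cV1] by blast
      have "w' + E * (8 + 1) \<le> q" using q(1) unfolding u_def by simp
      then have size: "2 ^ w' * 2 ^ (E * (8 + 1)) \<le> (2::nat) ^ q"
        unfolding power_add[symmetric] by (intro power_increasing) auto
      have new: "dense3 (P False) (2 ^ w') 8 (V' i) (V' j) (V' l)" if "j < l" for l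
      proof (rule dense3_subset[OF blue(7)])
        show "V' i \<subseteq> X" using q(2) by (metis V1_def)
        show "V' j \<subseteq> Y" using q(2) True by (metis V1_def less_irrefl)
        show "V' l \<subseteq> Z" using q(2) True that by (metis V1_def less_irrefl less_asym)
      qed
      have le: "p \<le> q + shrinkage E (Suc r)" using q(1) p(1) unfolding g by simp
      have sub: "\<forall>l. V' l \<subseteq> V l \<and> card (V' l) = 2 ^ q" using q(2) V1V by blast
      show ?thesis using finish[OF le sub dense new size] .
    qed
  qed
qed

section \<open>Counting solutions of linear constraint systems\<close>

text \<open>Assignments are extensional, so each is determined by its restrictions to
  \<open>e\<close> and \<open>V - e\<close>.\<close>

definition solutions :: "'a set \<Rightarrow> ('a \<Rightarrow> 'v set) \<Rightarrow> ('a set \<Rightarrow> ('a \<Rightarrow> 'v) \<Rightarrow> bool) \<Rightarrow> 'a set set \<Rightarrow> ('a \<Rightarrow> 'v) set" where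
  "solutions V U R C = {x \<in> PiE V U. \<forall>e\<in>C. R e x}"

definition linear_family :: "'a set set \<Rightarrow> bool" where
  "linear_family C \<longleftrightarrow> (\<forall>e\<in>C. \<forall>f\<in>C. e \<noteq> f \<longrightarrow> (\<forall>a\<in>e \<inter> f. \<forall>b\<in>e \<inter> f. a = b))"

text \<open>With \<open>y\<close> fixed outside \<open>e\<close>, linearity lets each constraint in
  \<open>C\<close> meet \<open>e\<close> in at most one vertex. It then speaks of \<open>y\<close>
  alone or restricts a single coordinate. The fibre over \<open>y\<close> is therefore empty or a
  product, and only \<open>R e\<close> links its coordinates.\<close>

lemma solutions_fibre:
  assumes lin: "linear_family (insert e C)" "e \<notin> C" and eV: "e \<subseteq> V" and CV: "\<And>f. f \<in> C \<Longrightarrow> f \<subseteq> V"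
    and loc: "\<And>f x y. f \<in> insert e C \<Longrightarrow> (\<And>v. v \<in> f \<Longrightarrow> x v = y v) \<Longrightarrow> R f x = R f y"
    and y: "y \<in> PiE (V - e) U"
  obtains X where "\<And>v. v \<in> e \<Longrightarrow> X v \<subseteq> U v"
    "card {x \<in> solutions V U R C. restrict x (V - e) = y} = card (PiE e X)"
    "card {x \<in> solutions V U R (insert e C). restrict x (V - e) = y} = card {z \<in> PiE e X. R e z}"
  | "{x \<in> solutions V U R C. restrict x (V - e) = y} = {}"
proof (cases "\<forall>f\<in>C. f \<inter> e = {} \<longrightarrow> R f y")
  case False
  then obtain f where f: "f \<in> C" "f \<inter> e = {}" "\<not> R f y" by blast
  have "R f (restrict x (V - e)) = R f x" for x
    using f CV[of f] by (intro loc) auto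
  then have "{x \<in> solutions V U R C. restrict x (V - e) = y} = {}"
    using f unfolding solutions_def by auto
  then show thesis by (rule that(2))
next
  case True
  \<comment> \<open>\<open>y\<close> carries no information on \<open>e\<close>, but a constraint
    through \<open>v\<close> sees no other vertex of \<open>e\<close>.\<close>
  define X where "X v = {u \<in> U v. \<forall>f\<in>C. v \<in> f \<longrightarrow> R f (y(v := u))}" for v
  have key: "(\<forall>f\<in>C. R f x) \<longleftrightarrow> (\<forall>v\<in>e. x v \<in> X v)"
    if x: "x \<in> PiE V U" "restrict x (V - e) = y" for x
  proof -
    have xy: "x v = y v" if "v \<in> V - e" for v using x(2) that by (metis restrict_apply')
    have one: "R f x = R f (y(v := x v))" if f: "f \<in> C" "v \<in> f" "v \<in> e" for f v
    proof (rule loc)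
      fix w assume w: "w \<in> f"
      have "w = v" if "w \<in> e"
        using lin f w that unfolding linear_family_def by (metis Int_iff insert_iff)
      then show "x w = (y(v := x v)) w" using w f CV[of f] xy by (cases "w \<in> e") auto
    qed (use f in simp)
    have none: "R f x" if f: "f \<in> C" "f \<inter> e = {}" for f
    proof -
      have "R f x = R f y" using f CV[of f] xy by (intro loc) auto
      then show ?thesis using True f by blast
    qed
    have xU: "x v \<in> U v" if "v \<in> e" for v using x(1) eV that by auto
    show ?thesis
    proof (intro iffI ballI)
      fix v assume "\<forall>f\<in>C. R f x" "v \<in> e"
      then have "R f (y(v := x v))" if "f \<in> C" "v \<in> f" for f
        using one[OF that] that by blast
      then show "x v \<in> X v" unfolding X_def using xU[OF \<open>v \<in> e\<close>] by blast
    next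
      fix f assume X: "\<forall>v\<in>e. x v \<in> X v" and f: "f \<in> C"
      show "R f x"
      proof (cases "f \<inter> e = {}")
        case True
        then show ?thesis by (rule none[OF f])
      next
        case False
        then obtain v where v: "v \<in> f" "v \<in> e" by blast
        then have "R f (y(v := x v))" using X f unfolding X_def by blast
        then show ?thesis using one[OF f v] by simp
      qed
    qed
  qed
  \<comment> \<open>On the fibre this is the inverse of restriction to \<open>e\<close>.\<close>
  let ?glue = "\<lambda>z v. if v \<in> e then z v else y v"
  have glue: "?glue z \<in> PiE V U" "restrict (?glue z) (V - e) = y" "restrict (?glue z) e = z" if "z \<in> PiE e X" for z
  proof -
    have "z v \<in> U v" if "v \<in> e" for v using \<open>z \<in> PiE e X\<close> that by (auto simp: X_def dest: PiE_mem)
    moreover have "y v \<in> U v" if "v \<in> V - e" for v using y that by (rule PiE_mem)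
    moreover have "y v = undefined" if "v \<notin> V - e" for v using y that by (rule PiE_arb)
    ultimately show "?glue z \<in> PiE V U" "restrict (?glue z) (V - e) = y"
      using eV by (auto simp: fun_eq_iff)
    have "z v = undefined" if "v \<notin> e" for v using \<open>z \<in> PiE e X\<close> that by (rule PiE_arb)
    then show "restrict (?glue z) e = z" by (auto simp: fun_eq_iff)
  qed
  have Re: "R e (restrict x e) = R e x" for x by (rule loc) auto
  have bij: "bij_betw (\<lambda>x. restrict x e) {x \<in> solutions V U R C. restrict x (V - e) = y} (PiE e X)"
  proof (rule bij_betw_byWitness[where f' = ?glue])
    show "\<forall>x\<in>{x \<in> solutions V U R C. restrict x (V - e) = y}. ?glue (restrict x e) = x"
    proof clarsimp
      fix x assume x: "x \<in> solutions V U R C" and "y = restrict x (V - e)"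
      then have "x v = undefined" if "v \<notin> V" for v
        using that unfolding solutions_def by (auto intro: PiE_arb)
      then show "(\<lambda>v. if v \<in> e then restrict x e v else restrict x (V - e) v) = x"
        using eV by (auto simp: fun_eq_iff)
    qed
    show "\<forall>z\<in>PiE e X. restrict (?glue z) e = z" using glue(3) by blast
    show "(\<lambda>x. restrict x e) ` {x \<in> solutions V U R C. restrict x (V - e) = y} \<subseteq> PiE e X"
      using key unfolding solutions_def by auto
    show "?glue ` PiE e X \<subseteq> {x \<in> solutions V U R C. restrict x (V - e) = y}"
    proof clarify
      fix z assume z: "z \<in> PiE e X"
      have "\<forall>f\<in>C. R f (?glue z)"
        using key[OF glue(1,2)[OF z]] z by (auto dest: PiE_mem)
      then show "?glue z \<in> solutions V U R C \<and> restrict (?glue z) (V - e) = y"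
        using glue[OF z] unfolding solutions_def by auto
    qed
  qed
  define S where "S = {x \<in> solutions V U R C. restrict x (V - e) = y}"
  have "(\<lambda>x. restrict x e) ` {x \<in> S. R e x} = {z \<in> (\<lambda>x. restrict x e) ` S. R e z}"
    by (auto simp: Re)
  then have img: "(\<lambda>x. restrict x e) ` {x \<in> S. R e x} = {z \<in> PiE e X. R e z}"
    unfolding bij_betw_imp_surj_on[OF bij[folded S_def]] .
  have inj: "inj_on (\<lambda>x. restrict x e) {x \<in> S. R e x}"
    by (rule inj_on_subset[OF bij_betw_imp_inj_on[OF bij[folded S_def]]]) auto
  have "card {x \<in> S. R e x} = card {z \<in> PiE e X. R e z}"
    using card_image[OF inj] unfolding img by simp
  moreover have "{x \<in> S. R e x} = {x \<in> solutions V U R (insert e C). restrict x (V - e) = y}"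
    unfolding solutions_def S_def by auto
  moreover have "X v \<subseteq> U v" for v unfolding X_def by auto
  ultimately show thesis
    using that(1)[of X] bij_betw_same_card[OF bij] by simp
qed

lemma card_solutions_fibres:
  assumes "finite V" "\<And>v. v \<in> V \<Longrightarrow> finite (U v)"
  shows "card (solutions V U R C) = (\<Sum>y\<in>PiE (V - e) U. card {x \<in> solutions V U R C. restrict x (V - e) = y})"
proof -
  have fin: "finite (PiE (V - e) U)" "finite (solutions V U R C)"
    using assms finite_PiE[of V U] unfolding solutions_def by (auto intro!: finite_PiE)
  have sub: "(\<lambda>x. restrict x (V - e)) ` solutions V U R C \<subseteq> PiE (V - e) U"
    unfolding solutions_def by auto
  show ?thesis using sum.group[OF fin(2,1) sub, of "\<lambda>_. 1::nat"] by simp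
qed

text \<open>The density hypothesis is summed over all fibres. The error of one fibre is relative to
  the product over \<open>e\<close>, and the assignments outside \<open>e\<close> contribute the
  product over \<open>V - e\<close>. Empty fibres are covered by
  \<open>0 \<le> \<mu>\<close>.\<close>

lemma card_solutions_insert:
  fixes d \<mu> :: real
  assumes lin: "linear_family (insert e C)" "e \<notin> C" and eV: "e \<subseteq> V" and CV: "\<And>f. f \<in> C \<Longrightarrow> f \<subseteq> V"
    and loc: "\<And>f x y. f \<in> insert e C \<Longrightarrow> (\<And>v. v \<in> f \<Longrightarrow> x v = y v) \<Longrightarrow> R f x = R f y"
    and fin: "finite V" "\<And>v. v \<in> V \<Longrightarrow> finite (U v)" and "0 \<le> \<mu>"
    and dense: "\<And>X. (\<And>v. v \<in> e \<Longrightarrow> X v \<subseteq> U v) \<Longrightarrow>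
      d * (\<Prod>v\<in>e. card (X v)) - \<mu> * (\<Prod>v\<in>e. card (U v)) \<le> card {z \<in> PiE e X. R e z}"
  shows "d * card (solutions V U R C) - \<mu> * (\<Prod>v\<in>V. card (U v)) \<le> card (solutions V U R (insert e C))"
proof -
  have fe: "finite e" using eV fin finite_subset by blast
  let ?F = "\<lambda>C y. {x \<in> solutions V U R C. restrict x (V - e) = y}"
  let ?\<mu> = "\<mu> * (\<Prod>v\<in>e. card (U v))"
  have "d * card (?F C y) - ?\<mu> \<le> card (?F (insert e C) y)" if "y \<in> PiE (V - e) U" for y
    using lin eV CV loc that
  proof (rule solutions_fibre)
    fix X assume X: "\<And>v. v \<in> e \<Longrightarrow> X v \<subseteq> U v"
      and c: "card (?F C y) = card (PiE e X)" "card (?F (insert e C) y) = card {z \<in> PiE e X. R e z}"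
    then show ?thesis using dense[OF X] fe by (simp add: card_PiE)
  next
    assume "?F C y = {}"
    then have "card (?F C y) = 0" by (simp only: card.empty)
    moreover have "0 \<le> ?\<mu>" using \<open>0 \<le> \<mu>\<close> by (intro mult_nonneg_nonneg) (auto simp: prod_nonneg)
    ultimately show ?thesis by simp
  qed
  then have "(\<Sum>y\<in>PiE (V - e) U. d * card (?F C y) - ?\<mu>) \<le> (\<Sum>y\<in>PiE (V - e) U. real (card (?F (insert e C) y)))"
    by (rule sum_mono)
  also have "\<dots> = card (solutions V U R (insert e C))"
    using card_solutions_fibres[OF fin, where R=R and e=e and C="insert e C"] by simp
  also have "(\<Sum>y\<in>PiE (V - e) U. d * card (?F C y) - ?\<mu>)
     = d * card (solutions V U R C) - card (PiE (V - e) U) * ?\<mu>"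
    using card_solutions_fibres[OF fin, where R=R and e=e and C=C] by (simp add: sum_subtractf sum_distrib_left)
  also have "card (PiE (V - e) U) * ?\<mu> = \<mu> * (\<Prod>v\<in>V. card (U v))"
    using prod.subset_diff[OF eV fin(1), of "\<lambda>v. real (card (U v))"] fin(1)
    by (simp add: card_PiE algebra_simps)
  finally show ?thesis .
qed

text \<open>The densities may differ wildly. Treating the sparsest constraint first makes its error term
  \<open>2 ^ -(E * (D e + 1))\<close> negligible against the product of all densities.\<close>

lemma card_solutions_lower_bound:
  fixes D :: "'a set \<Rightarrow> nat"
  assumes finV: "finite V" "\<And>v. v \<in> V \<Longrightarrow> finite (U v)"
    and "finite C" "card C \<le> E" "linear_family C" "\<forall>e\<in>C. e \<subseteq> V"
    and "\<forall>f\<in>C. \<forall>x y. (\<forall>v\<in>f. x v = y v) \<longrightarrow> R f x = R f y"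
    and "\<forall>e\<in>C. \<forall>X. (\<forall>v\<in>e. X v \<subseteq> U v \<and> card (U v) \<le> 2 ^ (E * (D e + 1)) * card (X v))
      \<longrightarrow> (\<Prod>v\<in>e. card (X v)) \<le> 2 ^ D e * card {z \<in> PiE e X. R e z}"
  shows "(\<Prod>v\<in>V. card (U v)) / 2 ^ (\<Sum>e\<in>C. D e + 1) \<le> card (solutions V U R C)"
  using assms(3-)
\<comment> \<open>Members enter in order of increasing \<open>D\<close>, so the inserted
  \<open>e\<close> is the sparsest constraint so far.\<close>
proof (induction C rule: finite_ranking_induct[where f = D])
  case empty
  then show ?case using finV by (simp add: solutions_def card_PiE)
next
  case (insert e C)
  show ?case
  proof (cases "e \<in> C")
    case True
    then have "insert e C = C" by blast
    then show ?thesis using insert.IH insert.prems by (simp only:)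
  next
    case False
    let ?U = "\<Prod>v\<in>V. real (card (U v))"
    \<comment> \<open>The relative size of \<open>X v\<close> in \<open>U v\<close> below which the
      density hypothesis is silent.\<close>
    define \<mu> :: real where "\<mu> = 1 / 2 ^ (E * (D e + 1))"
    have loc: "R f x = R f y" if "f \<in> insert e C" "\<And>v. v \<in> f \<Longrightarrow> x v = y v" for f x y
      using insert.prems(4) that by blast
    have eV: "e \<subseteq> V" and CV: "\<And>f. f \<in> C \<Longrightarrow> f \<subseteq> V" using insert.prems(3) by simp_all
    have fe: "finite e" using eV finV finite_subset by blast
    have IH: "?U / 2 ^ (\<Sum>e\<in>C. D e + 1) \<le> card (solutions V U R C)"
    proof -
      have "card C \<le> E" using insert.prems(1) insert.hyps \<open>e \<notin> C\<close> by simp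
      moreover have "linear_family C" using insert.prems(2) unfolding linear_family_def by blast
      ultimately have "real (\<Prod>v\<in>V. card (U v)) / 2 ^ (\<Sum>e\<in>C. D e + 1) \<le> card (solutions V U R C)"
          using insert.prems(3-) by (intro insert.IH) (blast+)
        then show ?thesis by (simp only: of_nat_prod)
    qed
    \<comment> \<open>If some \<open>X v\<close> is too small for the density hypothesis, the whole
      product over \<open>e\<close> is within the error term and the left side is not
      positive.\<close>
    have dense: "1 / 2 ^ D e * (\<Prod>v\<in>e. card (X v)) - \<mu> * (\<Prod>v\<in>e. card (U v)) \<le> card {z \<in> PiE e X. R e z}"
      if X: "\<And>v. v \<in> e \<Longrightarrow> X v \<subseteq> U v" for X
    proof (cases "\<forall>v\<in>e. card (U v) \<le> 2 ^ (E * (D e + 1)) * card (X v)")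
      case True
      then have "(\<Prod>v\<in>e. card (X v)) \<le> 2 ^ D e * card {z \<in> PiE e X. R e z}"
        using insert.prems(5) X by (simp only: ball_simps) blast
      then have "real (\<Prod>v\<in>e. card (X v)) \<le> real (2 ^ D e * card {z \<in> PiE e X. R e z})"
        by (simp only: of_nat_le_iff)
      then have "1 / 2 ^ D e * (\<Prod>v\<in>e. card (X v)) \<le> card {z \<in> PiE e X. R e z}"
        by (simp add: field_simps)
      moreover have "0 \<le> \<mu> * (\<Prod>v\<in>e. card (U v))" by (simp add: \<mu>_def prod_nonneg)
      ultimately show ?thesis by linarith
    next
      case False
      then obtain v where v: "v \<in> e" "2 ^ (E * (D e + 1)) * card (X v) < card (U v)" by (auto simp: not_le)
      have "real (2 ^ (E * (D e + 1)) * card (X v)) \<le> real (card (U v))" using v(2) by (intro of_nat_mono) simp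
      then have small: "real (card (X v)) \<le> \<mu> * card (U v)" by (simp add: \<mu>_def field_simps)
      have le: "real (card (X w)) \<le> card (U w)" if "w \<in> e" for w
        using X[OF that] finV eV that by (auto intro!: card_mono)
      have "1 / 2 ^ D e * real (\<Prod>v\<in>e. card (X v)) \<le> 1 * real (\<Prod>v\<in>e. card (X v))"
        by (intro mult_right_mono) (auto simp: prod_nonneg)
      also have "\<dots> = card (X v) * (\<Prod>w\<in>e - {v}. real (card (X w)))"
        using v fe by (simp add: prod.remove)
      also have "\<dots> \<le> (\<mu> * card (U v)) * (\<Prod>w\<in>e - {v}. real (card (U w)))"
        using small le by (intro mult_mono prod_mono) (auto simp: prod_nonneg \<mu>_def)
      also have "\<dots> = \<mu> * (\<Prod>v\<in>e. card (U v))" using v fe by (simp add: prod.remove)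
      finally have "1 / 2 ^ D e * real (\<Prod>v\<in>e. card (X v)) \<le> \<mu> * (\<Prod>v\<in>e. card (U v))" .
      then show ?thesis by linarith
    qed
    have step: "1 / 2 ^ D e * card (solutions V U R C) - \<mu> * (\<Prod>v\<in>V. card (U v))
        \<le> card (solutions V U R (insert e C))"
      using insert.prems(2) \<open>e \<notin> C\<close> eV CV loc finV _ dense
      by (rule card_solutions_insert) (auto simp: \<mu>_def)
    \<comment> \<open>Here the order of insertion pays off: \<open>D e\<close> is maximal among at
      most \<open>E\<close> members.\<close>
    have exponent: "(\<Sum>f\<in>insert e C. D f + 1) \<le> E * (D e + 1)"
    proof -
      have "(\<Sum>f\<in>insert e C. D f + 1) \<le> (\<Sum>f\<in>insert e C. D e + 1)"
        using insert.hyps by (intro sum_mono) auto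
      also have "\<dots> = card (insert e C) * (D e + 1)" by simp
      also have "\<dots> \<le> E * (D e + 1)" using insert.prems(1) by (intro mult_right_mono) auto
      finally show ?thesis .
    qed
    have U0: "0 \<le> ?U" by (simp add: prod_nonneg)
    have "\<mu> \<le> 1 / 2 ^ (\<Sum>f\<in>insert e C. D f + 1)"
      unfolding \<mu>_def using exponent by (intro divide_left_mono power_increasing) auto
    then have "\<mu> * ?U \<le> ?U / 2 ^ (\<Sum>f\<in>insert e C. D f + 1)"
      using mult_right_mono[OF _ U0] by fastforce
    \<comment> \<open>The extra 1 in each exponent makes the main term twice the target; the error
      consumes at most one of the two copies.\<close>
    moreover have "2 * (?U / 2 ^ (\<Sum>f\<in>insert e C. D f + 1)) = 1 / 2 ^ D e * (?U / 2 ^ (\<Sum>f\<in>C. D f + 1))"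
      using insert.hyps \<open>e \<notin> C\<close> by (simp add: power_add)
    moreover have "1 / 2 ^ D e * (?U / 2 ^ (\<Sum>f\<in>C. D f + 1)) \<le> 1 / 2 ^ D e * card (solutions V U R C)"
      using IH by (intro mult_left_mono) auto
    ultimately show ?thesis using step by (simp only: of_nat_prod)
  qed
qed

section \<open>Ramsey bound for pairs\<close>

text \<open>The least element splits the others by the colour of their pair with it. One class has
  at least \<open>2 ^ (k + l - 1)\<close> elements, and a homogeneous set of that colour found there
  is extended by the least element.\<close>

lemma ramsey_pairs:
  fixes c :: "nat \<Rightarrow> nat \<Rightarrow> bool"
  assumes "finite A" "2 ^ (k + l) \<le> card A"
  shows "(\<exists>I\<subseteq>A. card I = k \<and> (\<forall>i\<in>I. \<forall>j\<in>I. i < j \<longrightarrow> c i j)) \<or>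
    (\<exists>I\<subseteq>A. card I = l \<and> (\<forall>i\<in>I. \<forall>j\<in>I. i < j \<longrightarrow> \<not> c i j))"
  using assms
proof (induction "k + l" arbitrary: k l A)
  case (Suc n)
  show ?case
  proof (cases "k = 0 \<or> l = 0")
    case True
    then show ?thesis by (metis card.empty empty_iff empty_subsetI)
  next
    case False
    have ne: "A \<noteq> {}" using Suc.prems(2) by auto
    define a where "a = Min A"
    have a: "a \<in> A" "\<And>b. b \<in> A \<Longrightarrow> a \<le> b"
      unfolding a_def using ne Suc.prems(1) by auto
    define B where "B = {b \<in> A - {a}. c a b}"
    define C where "C = {b \<in> A - {a}. \<not> c a b}"
    have fin: "finite B" "finite C" "B \<inter> C = {}" "B \<union> C = A - {a}"
      using Suc.prems(1) by (auto simp: B_def C_def)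
    then have "card B + card C = card A - 1"
      using card_Un_disjoint[of B C] a Suc.prems(1) by simp
    moreover have "(2::nat) ^ (k + l) = 2 * 2 ^ n" using Suc.hyps(2) by (metis power_Suc)
    moreover have "(2::nat) ^ n \<ge> 1" by simp
    ultimately consider "2 ^ n \<le> card B" | "2 ^ n \<le> card C" using Suc.prems(2) by linarith
    then show ?thesis
    proof cases
      case 1
      have "n = (k - 1) + l" using Suc.hyps(2) False by simp
      then consider I where "I \<subseteq> B" "card I = k - 1" "\<forall>i\<in>I. \<forall>j\<in>I. i < j \<longrightarrow> c i j"
        | I where "I \<subseteq> B" "card I = l" "\<forall>i\<in>I. \<forall>j\<in>I. i < j \<longrightarrow> \<not> c i j"
        using Suc.hyps(1)[of "k - 1" l B] 1 fin by auto
      then show ?thesis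
      proof cases
        case (1 I)
        have I: "finite I" "a \<notin> I" "I \<subseteq> A" using 1(1) finite_subset[OF 1(1) fin(1)] unfolding B_def by blast+
        have "card (insert a I) = k" using 1 I False by simp
        moreover have "\<forall>i\<in>insert a I. \<forall>j\<in>insert a I. i < j \<longrightarrow> c i j"
        proof (intro ballI impI)
          fix i j assume ij: "i \<in> insert a I" "j \<in> insert a I" "i < j"
          have "a \<le> i" using ij(1) I(3) a by blast
          then have "j \<noteq> a" using ij(3) by simp
          then show "c i j" using ij 1 unfolding B_def by blast
        qed
        moreover have "insert a I \<subseteq> A" using I a by simp
        ultimately show ?thesis by blast
      next
        case (2 I)
        note 2(2,3)
        moreover have "I \<subseteq> A" using 2(1) unfolding B_def by blast
        ultimately show ?thesis by blast
      qed
    next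
      case 2
      have "n = k + (l - 1)" using Suc.hyps(2) False by simp
      then consider I where "I \<subseteq> C" "card I = l - 1" "\<forall>i\<in>I. \<forall>j\<in>I. i < j \<longrightarrow> \<not> c i j"
        | I where "I \<subseteq> C" "card I = k" "\<forall>i\<in>I. \<forall>j\<in>I. i < j \<longrightarrow> c i j"
        using Suc.hyps(1)[of k "l - 1" C] 2 fin by auto
      then show ?thesis
      proof cases
        case (1 I)
        have I: "finite I" "a \<notin> I" "I \<subseteq> A" using 1(1) finite_subset[OF 1(1) fin(2)] unfolding C_def by blast+
        have "card (insert a I) = l" using 1 I False by simp
        moreover have "\<forall>i\<in>insert a I. \<forall>j\<in>insert a I. i < j \<longrightarrow> \<not> c i j"
        proof (intro ballI impI)
          fix i j assume ij: "i \<in> insert a I" "j \<in> insert a I" "i < j"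
          have "a \<le> i" using ij(1) I(3) a by blast
          then have "j \<noteq> a" using ij(3) by simp
          then show "\<not> c i j" using ij 1 unfolding C_def by blast
        qed
        moreover have "insert a I \<subseteq> A" using I a by simp
        ultimately show ?thesis by blast
      next
        case (2 I)
        note 2(2,3)
        moreover have "I \<subseteq> A" using 2(1) unfolding C_def by blast
        ultimately show ?thesis by blast
      qed
    qed
  qed
next
  case 0
  then show ?case by (metis add_is_0 card.empty empty_iff empty_subsetI)
qed

section \<open>Embedding the graph\<close>

text \<open>Twice the size condition of the sequence construction, with \<open>E = n * n\<close>,
  \<open>m = 2 ^ (2 * n)\<close> and \<open>l = K div 2 + 3\<close>. Everything is at most
  \<open>32 * B\<close>, which is only doubly exponential in \<open>n\<close>.\<close>

lemma iterated_exponential_bound: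
  assumes "1 \<le> n" "K = 2 ^ 2 ^ (40 * n)"
  shows "4 * shrinkage (n * n) (2 ^ (2 * n) * 2 ^ (2 * n)) + 18 * (n * n) + 10 \<le> K"
proof -
  let ?r = "2 ^ (2 * n) * 2 ^ (2 * n) :: nat"
  define B where "B = (50 * (n * n)) ^ (?r + 1)"
  have n: "n \<le> 2 ^ n" by (simp add: less_imp_le)
  have nn: "1 \<le> n * n" using assms(1) by simp
  have "n * n \<le> 50 * (n * n)" by simp
  also have "\<dots> \<le> B" unfolding B_def using nn by (intro self_le_power) auto
  finally have 1: "18 * (n * n) + 10 \<le> 28 * B" using nn by linarith
  have 2: "shrinkage (n * n) ?r \<le> B" unfolding B_def by (rule shrinkage_le[OF nn])
  have r: "?r = 2 ^ (4 * n)" unfolding power_add[symmetric] by simp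
  have pow: "(2::nat) ^ a \<le> 2 ^ (b * n)" if "a \<le> b" for a b
  proof -
    have "a \<le> b * n" using that mult_le_mono[OF that assms(1)] by simp
    then show ?thesis by (intro power_increasing) auto
  qed
  have "50 * (n * n) \<le> 2 ^ (6 * n) * (2 ^ n * 2 ^ n)"
    using pow[of 6 6] n by (intro mult_mono) auto
  also have "\<dots> = 2 ^ (8 * n)" unfolding power_add[symmetric] by simp
  finally have "B \<le> (2 ^ (8 * n)) ^ (?r + 1)" unfolding B_def by (intro power_mono) auto
  also have "\<dots> = 2 ^ (8 * n * (2 ^ (4 * n) + 1))" unfolding r by (simp only: power_mult)
  finally have "32 * B \<le> 2 ^ 5 * 2 ^ (8 * n * (2 ^ (4 * n) + 1))" by simp
  also have "\<dots> = 2 ^ (5 + 8 * n * (2 ^ (4 * n) + 1))" by (simp only: power_add)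
  also have "\<dots> \<le> 2 ^ 2 ^ (40 * n)"
  proof (rule power_increasing)
    have "8 * n * (2 ^ (4 * n) + 1) \<le> 2 ^ (3 * n) * 2 ^ n * (2 ^ (4 * n) + 2 ^ (4 * n))"
      using pow[of 3 3] n by (intro mult_mono add_mono) auto
    also have "\<dots> = 2 ^ (8 * n + 1)" by (simp add: power_add[symmetric] flip: mult_2)
    also have "\<dots> \<le> 2 ^ (9 * n)" using assms(1) by (intro power_increasing) auto
    finally have "5 + 8 * n * (2 ^ (4 * n) + 1) \<le> 2 ^ (3 * n) + 2 ^ (9 * n)"
      using pow[of 3 3] by simp
    also have "\<dots> \<le> 2 ^ (9 * n) + 2 ^ (9 * n)" by simp
    also have "\<dots> = 2 ^ (9 * n + 1)" by simp
    also have "\<dots> \<le> 2 ^ (40 * n)" using assms(1) by (intro power_increasing) auto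
    finally show "5 + 8 * n * (2 ^ (4 * n) + 1) \<le> 2 ^ (40 * n)" .
  qed simp
  finally have "32 * B \<le> K" using assms(2) by simp
  then show ?thesis using 1 2 by linarith
qed

section \<open>From counted tuples to counted assignments\<close>

lemma count2_le_card_PiE:
  assumes "a \<noteq> b" "finite (X a)" "finite (X b)"
    and "\<And>x y. x \<in> X a \<Longrightarrow> y \<in> X b \<Longrightarrow> P x y \<Longrightarrow> Q ((\<lambda>_. undefined)(a := x, b := y))"
  shows "count2 P (X a) (X b) \<le> card {z \<in> PiE {a, b} X. Q z}"
proof -
  let ?S = "{p \<in> X a \<times> X b. P (fst p) (snd p)}"
  have "count2 P (X a) (X b) = (\<Sum>p\<in>X a \<times> X b. of_bool (P (fst p) (snd p)))"
    unfolding count2_def by (simp add: sum.cartesian_product case_prod_beta del: sum_of_bool_eq)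
  also have "\<dots> = card ?S" using assms(2,3) by (simp add: Int_def)
  also have "\<dots> \<le> card {z \<in> PiE {a, b} X. Q z}"
  proof (rule card_inj_on_le[where f = "\<lambda>p. (\<lambda>_. undefined)(a := fst p, b := snd p)"])
    show "inj_on (\<lambda>p. (\<lambda>_. undefined)(a := fst p, b := snd p)) ?S"
      using \<open>a \<noteq> b\<close> by (auto simp: inj_on_def fun_eq_iff)
    show "(\<lambda>p. (\<lambda>_. undefined)(a := fst p, b := snd p)) ` ?S \<subseteq> {z \<in> PiE {a, b} X. Q z}"
      using assms(1,4) by (auto simp: PiE_iff extensional_def)
    show "finite {z \<in> PiE {a, b} X. Q z}" using assms(2,3) by (auto intro!: finite_subset[OF _ finite_PiE[of "{a, b}" X]])
  qed
  finally show ?thesis .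
qed

lemma count3_le_card_PiE:
  assumes "a \<noteq> b" "a \<noteq> c" "b \<noteq> c" "finite (X a)" "finite (X b)" "finite (X c)"
    and "\<And>x y z. x \<in> X a \<Longrightarrow> y \<in> X b \<Longrightarrow> z \<in> X c \<Longrightarrow> P x y z
      \<Longrightarrow> Q ((\<lambda>_. undefined)(a := x, b := y, c := z))"
  shows "count3 P (X a) (X b) (X c) \<le> card {z \<in> PiE {a, b, c} X. Q z}"
proof -
  let ?S = "{p \<in> X a \<times> X b \<times> X c. P (fst p) (fst (snd p)) (snd (snd p))}"
  let ?f = "\<lambda>p. (\<lambda>_. undefined)(a := fst p, b := fst (snd p), c := snd (snd p))"
  have "count3 P (X a) (X b) (X c) = (\<Sum>p\<in>X a \<times> X b \<times> X c. of_bool (P (fst p) (fst (snd p)) (snd (snd p))))"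
    unfolding count3_def by (simp add: sum.cartesian_product case_prod_beta del: sum_of_bool_eq)
  also have "\<dots> = card ?S" using assms(4-6) by (simp add: Int_def)
  also have "\<dots> \<le> card {z \<in> PiE {a, b, c} X. Q z}"
  proof (rule card_inj_on_le[where f = ?f])
    have "p = q" if "?f p = ?f q" for p q
    proof -
      have "?f p a = ?f q a" "?f p b = ?f q b" "?f p c = ?f q c" using that by metis+
      then show ?thesis using assms(1-3) by (simp add: prod_eq_iff)
    qed
    then show "inj_on ?f ?S" by (intro inj_onI)
    show "?f ` ?S \<subseteq> {z \<in> PiE {a, b, c} X. Q z}"
      using assms(1-3,7) by (auto simp: PiE_iff extensional_def)
    show "finite {z \<in> PiE {a, b, c} X. Q z}" using assms(4-6) by (auto intro!: finite_subset[OF _ finite_PiE[of "{a, b, c}" X]])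
  qed
  finally show ?thesis .
qed

text \<open>Density is known only for increasing indices, so the vertices of a triangle have to be
  sorted by position.\<close>

lemma card_3_ordered:
  fixes \<phi> :: "'a \<Rightarrow> nat"
  assumes "card e = 3" "inj_on \<phi> e"
  obtains a b c where "e = {a, b, c}" "\<phi> a < \<phi> b" "\<phi> b < \<phi> c"
proof -
  obtain x y z where e: "e = {x, y, z}" "x \<noteq> y" "y \<noteq> z" "x \<noteq> z"
    using assms(1) by (auto simp: card_3_iff)
  have "\<phi> x \<noteq> \<phi> y" "\<phi> y \<noteq> \<phi> z" "\<phi> x \<noteq> \<phi> z" using assms(2) e by (auto simp: inj_on_def)
  then consider "\<phi> x < \<phi> y \<and> \<phi> y < \<phi> z" | "\<phi> x < \<phi> z \<and> \<phi> z < \<phi> y" | "\<phi> y < \<phi> x \<and> \<phi> x < \<phi> z"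
    | "\<phi> y < \<phi> z \<and> \<phi> z < \<phi> x" | "\<phi> z < \<phi> x \<and> \<phi> x < \<phi> y" | "\<phi> z < \<phi> y \<and> \<phi> y < \<phi> x"
    by linarith
  then show thesis
  proof cases
    case 1 then show ?thesis using that[of x y z] e by auto
  next
    case 2 then show ?thesis using that[of x z y] e by auto
  next
    case 3 then show ?thesis using that[of y x z] e by auto
  next
    case 4 then show ?thesis using that[of y z x] e by auto
  next
    case 5 then show ?thesis using that[of z x y] e by auto
  next
    case 6 then show ?thesis using that[of z y x] e by auto
  qed
qed

section \<open>Induced copies given by embeddings\<close>

lemma induced_copy_of_embedding:
  assumes F: "pair_graph F" and G: "pair_graph G"
    and inj: "inj_on x (pverts F)" and sub: "x ` pverts F \<subseteq> pverts G"
    and arcs: "\<And>a b. a \<in> pverts F \<Longrightarrow> b \<in> pverts F \<Longrightarrow> (x a, x b) \<in> parcs G \<longleftrightarrow> (a, b) \<in> parcs F"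
  defines "H \<equiv> \<lparr>pverts = x ` pverts F, parcs = map_prod x x ` parcs F\<rparr>"
  shows "induced_copy H F G" "T \<in> triangles H \<Longrightarrow> \<exists>S\<in>triangles F. T = x ` S"
proof -
  interpret F: pair_graph F by fact
  interpret G: pair_graph G by fact
  have wf: "wf_digraph (with_proj H)"
    unfolding wf_digraph_def H_def by (auto dest: F.in_arcsD1 F.in_arcsD2)
  have mem: "(a, b) \<in> parcs F \<Longrightarrow> a \<in> pverts F \<and> b \<in> pverts F" for a b
    using F.in_arcsD1 F.in_arcsD2 by blast
  have "parcs H = {e \<in> parcs G. fst e \<in> pverts H \<and> snd e \<in> pverts H}"
    unfolding H_def using arcs mem by (force simp: image_iff)
  then have "induced_subgraph (with_proj H) (with_proj G)"
    unfolding induced_subgraph_def subgraph_def compatible_def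
    using wf G.wf_digraph_axioms sub by (auto simp: H_def)
  moreover have "digraph_iso (with_proj F) (with_proj H)"
    unfolding digraph_iso_def
  proof (intro exI conjI)
    let ?h = "\<lparr>iso_verts = x, iso_arcs = map_prod x x, iso_head = snd, iso_tail = fst\<rparr>"
    have "inj_on (map_prod x x) (parcs F)"
      using inj mem unfolding inj_on_def by auto
    then show "pre_digraph.digraph_isomorphism (with_proj F) ?h"
      unfolding pre_digraph.digraph_isomorphism_def using inj F.wf_digraph_axioms by auto
    show "with_proj H = app_iso ?h (with_proj F)"
      by (simp add: H_def app_iso_def with_proj_def)
  qed
  ultimately show "induced_copy H F G" unfolding induced_copy_def by blast
  show "\<exists>S\<in>triangles F. T = x ` S" if "T \<in> triangles H"
  proof -
    from that have T: "T \<subseteq> x ` pverts F" "card T = 3"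
      "\<And>u v. u \<in> T \<Longrightarrow> v \<in> T \<Longrightarrow> u \<noteq> v \<Longrightarrow> (u, v) \<in> map_prod x x ` parcs F"
      unfolding triangles_def H_def by auto
    obtain S where S: "S \<subseteq> pverts F" "T = x ` S" using T(1) by (auto simp: subset_image_iff)
    have "card S = 3" using T(2) S inj by (metis card_image inj_on_subset)
    moreover have "(a, b) \<in> parcs F" if "a \<in> S" "b \<in> S" "a \<noteq> b" for a b
    proof -
      have "x a \<noteq> x b" using inj that S by (auto simp: inj_on_def)
      then have "(x a, x b) \<in> map_prod x x ` parcs F" using T(3) S(2) that by blast
      then obtain a' b' where "(a', b') \<in> parcs F" "x a = x a'" "x b = x b'" by auto
      then show ?thesis using inj that S mem unfolding inj_on_def by (metis subsetD)
    qed
    ultimately show ?thesis using S unfolding triangles_def by blast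
  qed
qed

section \<open>The host graph\<close>

definition hadamard_graph :: "nat \<Rightarrow> nat pair_pre_digraph" where
  "hadamard_graph k = \<lparr>pverts = {..<2 ^ k},
     parcs = {(x, y). x < 2 ^ k \<and> y < 2 ^ k \<and> x \<noteq> y \<and> sylvester k x y = - 1}\<rparr>"

lemma pair_graph_hadamard_graph: "pair_graph (hadamard_graph k)"
proof
  let ?G = "hadamard_graph k"
  show "finite (parcs ?G)"
    by (rule finite_subset[of _ "{..<2 ^ k} \<times> {..<2 ^ k}"]) (auto simp: hadamard_graph_def)
  show "symmetric (with_proj ?G)"
    unfolding symmetric_def by (auto simp: sym_def hadamard_graph_def sylvester_commute)
qed (auto simp: hadamard_graph_def)

text \<open>If \<open>K3 F\<close> is linear, each pair of vertices lies in exactly one member. The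
  two-element members are the edges in no triangle and the non-edges, so conditions on members
  control adjacency, non-adjacency and triangle colours at once.\<close>

definition pattern :: "'a pair_pre_digraph \<Rightarrow> 'a set set" where
  "pattern F = triangles F \<union> {{a, b} | a b. a \<in> pverts F \<and> b \<in> pverts F \<and> a \<noteq> b \<and>
     \<not> (\<exists>T\<in>triangles F. a \<in> T \<and> b \<in> T)}"

lemma pattern_cases:
  assumes "e \<in> pattern F"
  obtains "e \<in> triangles F"
  | a b where "e = {a, b}" "a \<in> pverts F" "b \<in> pverts F" "a \<noteq> b" "\<And>T. T \<in> triangles F \<Longrightarrow> \<not> (a \<in> T \<and> b \<in> T)"
  using assms unfolding pattern_def by blast

lemma pattern_subset: "e \<in> pattern F \<Longrightarrow> e \<subseteq> pverts F"
  by (erule pattern_cases) (auto simp: triangles_def)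

lemma pattern_covers:
  assumes "a \<in> pverts F" "b \<in> pverts F" "a \<noteq> b"
  obtains e where "e \<in> pattern F" "a \<in> e" "b \<in> e"
proof (cases "\<exists>T\<in>triangles F. a \<in> T \<and> b \<in> T")
  case True
  then show ?thesis using that unfolding pattern_def by blast
next
  case False
  then have "{a, b} \<in> pattern F" using assms unfolding pattern_def by blast
  then show ?thesis using that by blast
qed

text \<open>Two triangles are handled by the hypothesis. A pair enters only if no triangle contains
  it, so it shares at most one vertex with a triangle, and distinct pairs share at most one vertex
  anyway.\<close>

lemma linear_family_pattern:
  assumes "linear_3graph (K3 F)"
  shows "linear_family (pattern F)"
  unfolding linear_family_def
proof (intro ballI impI, rule ccontr)
  fix e f a b
  assume e: "e \<in> pattern F" and f: "f \<in> pattern F" and "e \<noteq> f"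
    and ab: "a \<in> e \<inter> f" "b \<in> e \<inter> f" "a \<noteq> b"
  have pair: False if "g \<notin> triangles F" "g \<in> pattern F" "h \<in> pattern F" "g \<noteq> h" "a \<in> g \<inter> h" "b \<in> g \<inter> h" for g h
  proof -
    from that(2,1) obtain u v where g: "g = {u, v}" "\<And>T. T \<in> triangles F \<Longrightarrow> \<not> (u \<in> T \<and> v \<in> T)"
      by (metis pattern_cases)
    then have gab: "g = {a, b}" using that(5,6) ab(3) by blast
    then have "u = a \<and> v = b \<or> u = b \<and> v = a" using g(1) by (auto simp: doubleton_eq_iff)
    then have "h \<notin> triangles F" using g(2)[of h] that(5,6) by blast
    with that(3) obtain u' v' where "h = {u', v'}" by (metis pattern_cases)
    then have "h = {a, b}" using that(5,6) ab(3) by blast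
    then show False using gab that(4) by simp
  qed
  show False
  proof (cases "e \<in> triangles F \<and> f \<in> triangles F")
    case True
    then have "card (e \<inter> f) \<le> 1" "card e = 3"
      using assms \<open>e \<noteq> f\<close> unfolding linear_3graph_def K3_def by auto
    moreover have "finite (e \<inter> f)" using \<open>card e = 3\<close> by (metis card.infinite finite_Int zero_neq_numeral)
    moreover have "card {a, b} \<le> card (e \<inter> f)" using ab \<open>finite (e \<inter> f)\<close> by (intro card_mono) auto
    ultimately show False using ab(3) by simp
  next
    case False
    then show False using pair[of e f] pair[of f e] e f ab \<open>e \<noteq> f\<close> by blast
  qed
qed

text \<open>Choosing two distinct vertices in each member maps the members to ordered pairs,
  injectively by linearity.\<close>

lemma card_pattern_le:
  assumes "finite (pverts F)" "linear_3graph (K3 F)"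
  shows "card (pattern F) \<le> card (pverts F) * card (pverts F)"
proof -
  have ex: "\<exists>p. fst p \<in> e \<and> snd p \<in> e \<and> fst p \<noteq> snd p" if "e \<in> pattern F" for e
    using that
  proof (cases rule: pattern_cases)
    case 1
    then have "card e = 3" by (simp add: triangles_def)
    then obtain a b c where "e = {a, b, c}" "a \<noteq> b" by (auto simp: card_3_iff)
    then show ?thesis by (intro exI[of _ "(a, b)"]) auto
  next
    case (2 a b)
    then show ?thesis by (intro exI[of _ "(a, b)"]) auto
  qed
  then obtain g where g: "\<And>e. e \<in> pattern F \<Longrightarrow> fst (g e) \<in> e \<and> snd (g e) \<in> e \<and> fst (g e) \<noteq> snd (g e)"
    by metis
  have "inj_on g (pattern F)"
  proof (rule inj_onI, rule ccontr)
    fix e f assume ef: "e \<in> pattern F" "f \<in> pattern F" "g e = g f" "e \<noteq> f"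
    then show False
      using linear_family_pattern[OF assms(2)] g[OF ef(1)] g[OF ef(2)] unfolding linear_family_def
      by (metis IntI)
  qed
  moreover have "g ` pattern F \<subseteq> pverts F \<times> pverts F"
  proof (rule image_subsetI)
    fix e assume "e \<in> pattern F"
    then show "g e \<in> pverts F \<times> pverts F"
      using g[of e] pattern_subset[of e F] unfolding mem_Times_iff by blast
  qed
  ultimately have "card (pattern F) \<le> card (pverts F \<times> pverts F)"
    using assms(1) by (intro card_inj_on_le) auto
  then show ?thesis by (simp add: card_cartesian_product)
qed

section \<open>Assembly of the monochromatic embedding\<close>

lemma monochromatic_induced_embedding:
  fixes F :: "'a pair_pre_digraph" and c :: "nat set \<Rightarrow> bool"
  assumes F: "pair_graph F" and n: "card (pverts F) = n" "1 \<le> n" and lin: "linear_3graph (K3 F)"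
    and K: "K = 2 ^ 2 ^ (40 * n)"
  shows "\<exists>x b. x ` pverts F \<subseteq> {..<2 ^ K} \<and>
    (\<forall>u\<in>pverts F. \<forall>v\<in>pverts F. u \<noteq> v \<longrightarrow> x u \<noteq> x v \<and> (sylvester K (x u) (x v) = - 1 \<longleftrightarrow> (u, v) \<in> parcs F)) \<and>
    (\<forall>T\<in>triangles F. c (x ` T) = b)"
proof -
  interpret F: pair_graph F by fact
  have finF: "finite (pverts F)" by simp
  \<comment> \<open>\<open>E\<close> bounds the number of constraints, \<open>2 ^ l\<close> is eight
    times the square root of \<open>2 ^ K\<close> as the density lemma requires, and
    \<open>m\<close> is the Ramsey bound for \<open>n\<close> indices in either colour.\<close>
  define E where "E = n * n"
  define l where "l = K div 2 + 3"
  define m :: nat where "m = 2 ^ (2 * n)"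
  define A where "A x y \<longleftrightarrow> x \<noteq> y \<and> sylvester K x y = - 1" for x y
  define P where "P \<beta> x y z \<longleftrightarrow> (A x y \<and> A x z \<and> A y z) \<and> c {x, y, z} = \<beta>" for \<beta> x y z
  let ?\<Omega> = "{..<2 ^ K} :: nat set"
  have "even K" unfolding K by simp
  then obtain h where h: "K = 2 * h" by blast
  then have l: "l = h + 3" unfolding l_def by simp
  \<comment> \<open>Since \<open>l\<close> contains half of \<open>K\<close>, the other terms have
    to fit into the other half; hence the doubled coefficients in the estimate.\<close>
  have size: "2 * shrinkage E (m * m) + (l + 2) + 9 * E \<le> K"
    using iterated_exponential_bound[OF n(2) K] h l unfolding E_def m_def by linarith
  have dense2: "card X * card Y \<le> 4 * count2 (\<lambda>x y. x \<noteq> y \<and> sylvester K x y = \<sigma>) X Y"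
    if "X \<subseteq> ?\<Omega>" "Y \<subseteq> ?\<Omega>" "2 ^ l \<le> card X" "2 ^ l \<le> card Y" "\<sigma> = 1 \<or> \<sigma> = - 1" for X Y \<sigma>
  proof (rule count2_sylvester[OF that(1,2) _ _ that(3-5)])
    show "K + 6 \<le> 2 * l" using h l by linarith
    show "4 \<le> l" using size h l by linarith
  qed
  have total: "card X * card Y * card Z \<le> 2 ^ 7 * (count3 (P True) X Y Z + count3 (P False) X Y Z)"
    if "X \<subseteq> ?\<Omega>" "Y \<subseteq> ?\<Omega>" "Z \<subseteq> ?\<Omega>" "2 ^ (l + 2) \<le> card X" "2 ^ (l + 2) \<le> card Y" "2 ^ (l + 2) \<le> card Z" for X Y Z
  proof -
    have "of_bool (A x y \<and> A x z \<and> A y z) = (of_bool (P True x y z) + of_bool (P False x y z) :: nat)" for x y z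
      unfolding P_def by auto
    then have "count3 (\<lambda>x y z. A x y \<and> A x z \<and> A y z) X Y Z = count3 (P True) X Y Z + count3 (P False) X Y Z"
      unfolding count3_def by (simp only: sum.distrib)
    moreover have "card X * card Y * card Z \<le> 2 ^ 7 * count3 (\<lambda>x y z. A x y \<and> A x z \<and> A y z) X Y Z"
      using _ _ that
    proof (rule triangle_count)
      fix X Y assume "X \<subseteq> ?\<Omega>" "Y \<subseteq> ?\<Omega>" "2 ^ l \<le> card X" "2 ^ l \<le> card Y"
      then show "card X * card Y \<le> 4 * count2 A X Y"
        using dense2[of X Y "- 1"] unfolding A_def by simp
    qed simp
    ultimately show ?thesis by simp
  qed
  have "\<exists>V' col q. K \<le> q + shrinkage E (m * m) \<and> (\<forall>k. V' k \<subseteq> ?\<Omega> \<and> card (V' k) = 2 ^ q) \<and>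
    (\<forall>i j k. i < j \<longrightarrow> j < k \<longrightarrow> j < m \<longrightarrow> 0 \<le> j * m + i \<longrightarrow>
      (\<exists>d s. dense3 (P (col i j)) s d (V' i) (V' j) (V' k) \<and> s * 2 ^ (E * (d + 1)) \<le> 2 ^ q))"
    by (rule homogeneous_dense_sequence[where V = "\<lambda>_. ?\<Omega>" and w = "l + 2" and t = 0, OF _ total])
      (use size in auto)
  then obtain V' col q where q: "K \<le> q + shrinkage E (m * m)"
    and V'\<Omega>_card: "\<forall>k. V' k \<subseteq> ?\<Omega> \<and> card (V' k) = 2 ^ q"
    and V'_dense: "\<forall>i j k. i < j \<longrightarrow> j < k \<longrightarrow> j < m \<longrightarrow> 0 \<le> j * m + i \<longrightarrow>
      (\<exists>d s. dense3 (P (col i j)) s d (V' i) (V' j) (V' k) \<and> s * 2 ^ (E * (d + 1)) \<le> 2 ^ q)"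
    by (elim exE conjE) (rule that)
  have V'\<Omega>: "V' k \<subseteq> ?\<Omega>" and cV': "card (V' k) = 2 ^ q" for k
    using V'\<Omega>_card by simp_all
  have V': "\<exists>d s. dense3 (P (col i j)) s d (V' i) (V' j) (V' k) \<and> s * 2 ^ (E * (d + 1)) \<le> 2 ^ q"
    if "i < j" "j < k" "j < m" for i j k
    using V'_dense that by simp
  \<comment> \<open>\<open>3 * E\<close> is \<open>E * (2 + 1)\<close>, the room needed by the
    pairs, whose density exponent is 2.\<close>
  have lq: "l + 3 * E \<le> q" using q size by linarith
  \<comment> \<open>The dense colour depends on the first two indices only, so Ramsey's theorem for
    pairs makes all increasing triples in \<open>I\<close> dense in one colour.\<close>
  have "2 ^ (n + n) \<le> card {..<m}" unfolding m_def by (simp add: mult_2)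
  from ramsey_pairs[OF finite_lessThan this, of col]
  obtain I b where I: "I \<subseteq> {..<m}" "card I = n" "\<And>i j. i \<in> I \<Longrightarrow> j \<in> I \<Longrightarrow> i < j \<Longrightarrow> col i j = b"
    by metis
  have "finite I" using I(1) finite_subset by blast
  then obtain \<phi> where \<phi>: "bij_betw \<phi> (pverts F) I"
    using finite_same_card_bij[OF finF] n(1) I(2) by metis
  define U where "U v = V' (\<phi> v)" for v
  \<comment> \<open>The local form of the goal: members cover all pairs and include all triangles,
    so satisfying \<open>R e\<close> for each of them gives the whole embedding.\<close>
  define R where "R e x \<longleftrightarrow> (\<forall>u\<in>e. \<forall>v\<in>e. u \<noteq> v \<longrightarrow> x u \<noteq> x v \<and> (sylvester K (x u) (x v) = - 1 \<longleftrightarrow> (u, v) \<in> parcs F))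
    \<and> (e \<in> triangles F \<longrightarrow> c (x ` e) = b)" for e and x :: "'a \<Rightarrow> nat"
  have symF: "(u, v) \<in> parcs F \<longleftrightarrow> (v, u) \<in> parcs F" for u v
    using F.pair_sym_arcs unfolding symmetric_def by (auto simp: sym_def)
  have finU: "finite (U v)" for v using V'\<Omega> finite_subset unfolding U_def by blast
  \<comment> \<open>The exponent of a triangle stems from the step that treated its first two
    indices, so each member has its own; they are collected into \<open>D\<close> below.\<close>
  have ex: "\<exists>d. \<forall>X. (\<forall>v\<in>e. X v \<subseteq> U v \<and> card (U v) \<le> 2 ^ (E * (d + 1)) * card (X v)) \<longrightarrow>
      (\<Prod>v\<in>e. card (X v)) \<le> 2 ^ d * card {z \<in> PiE e X. R e z}" if "e \<in> pattern F" for e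
    using that
  proof (cases rule: pattern_cases)
    case 1
    then have e: "card e = 3" "e \<subseteq> pverts F" unfolding triangles_def by auto
    have "inj_on \<phi> e" using \<phi> e(2) by (metis bij_betw_imp_inj_on inj_on_subset)
    from e(1) this obtain u v w where uvw: "e = {u, v, w}" "\<phi> u < \<phi> v" "\<phi> v < \<phi> w"
      by (rule card_3_ordered)
    have mem: "\<phi> u \<in> I" "\<phi> v \<in> I" "\<phi> w \<in> I" using \<phi> e(2) uvw(1) by (auto simp: bij_betw_def)
    have "\<phi> v < m" using mem I(1) by blast
    moreover have "col (\<phi> u) (\<phi> v) = b" using I(3) mem uvw by blast
    ultimately obtain d s where ds: "dense3 (P b) s d (U u) (U v) (U w)" "s * 2 ^ (E * (d + 1)) \<le> 2 ^ q"
      using V'[OF uvw(2,3)] unfolding U_def by auto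
    have dist: "u \<noteq> v" "u \<noteq> w" "v \<noteq> w" using uvw by auto
    have arcs: "(y, z) \<in> parcs F" if "y \<in> e" "z \<in> e" "y \<noteq> z" for y z
      using 1 that unfolding triangles_def by auto
    show ?thesis
    proof (intro exI[of _ d] allI impI)
      fix X assume X: "\<forall>v\<in>e. X v \<subseteq> U v \<and> card (U v) \<le> 2 ^ (E * (d + 1)) * card (X v)"
      \<comment> \<open>The relative size condition on \<open>X\<close> uses up exactly the room
        left between \<open>s\<close> and \<open>2 ^ q\<close>.\<close>
      have large: "s \<le> card (X y)" if "y \<in> e" for y
      proof -
        have "s * 2 ^ (E * (d + 1)) \<le> card (X y) * 2 ^ (E * (d + 1))"
          using X that ds(2) cV' unfolding U_def by (metis mult.commute order_trans)
        then show ?thesis by simp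
      qed
      have fX: "finite (X y)" if "y \<in> e" for y using X that finU finite_subset by blast
      have "(\<Prod>v\<in>e. card (X v)) = card (X u) * card (X v) * card (X w)"
        unfolding uvw(1) using dist by simp
      also have "\<dots> \<le> 2 ^ d * count3 (P b) (X u) (X v) (X w)"
        using ds(1) X large unfolding dense3_def uvw(1) by auto
      also have "count3 (P b) (X u) (X v) (X w) \<le> card {z \<in> PiE {u, v, w} X. R e z}"
      proof (rule count3_le_card_PiE[OF dist])
        fix x y z assume "P b x y z"
        then have xyz: "A x y" "A x z" "A y z" "c {x, y, z} = b" unfolding P_def by auto
        let ?f = "(\<lambda>_. undefined)(u := x, v := y, w := z)"
        have "?f ` e = {x, y, z}" unfolding uvw(1) using dist by auto
        moreover have "?f y' \<noteq> ?f z' \<and> sylvester K (?f y') (?f z') = - 1" if "y' \<in> e" "z' \<in> e" "y' \<noteq> z'" for y' z'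
          using that dist xyz sylvester_commute[of K] unfolding uvw(1) A_def by auto
        ultimately show "R e ?f" unfolding R_def using arcs xyz(4) by auto
      qed (use fX uvw(1) in auto)
      finally show "(\<Prod>v\<in>e. card (X v)) \<le> 2 ^ d * card {z \<in> PiE e X. R e z}"
        unfolding uvw(1) by simp
    qed
  next
    case (2 u v)
    \<comment> \<open>The sign encoding an edge or a non-edge. Both signs are dense, which makes the
      copy induced.\<close>
    define \<sigma> :: int where "\<sigma> = (if (u, v) \<in> parcs F then - 1 else 1)"
    have notri: "e \<notin> triangles F" using 2 by blast
    show ?thesis
    proof (intro exI[of _ 2] allI impI)
      fix X assume X: "\<forall>v\<in>e. X v \<subseteq> U v \<and> card (U v) \<le> 2 ^ (E * (2 + 1)) * card (X v)"
      have large: "2 ^ l \<le> card (X y)" if "y \<in> e" for y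
      proof -
        have "(2::nat) ^ l * 2 ^ (E * (2 + 1)) \<le> 2 ^ q"
          unfolding power_add[symmetric] using lq by (intro power_increasing) auto
        then have "2 ^ l * 2 ^ (E * (2 + 1)) \<le> card (X y) * 2 ^ (E * (2 + 1))"
          using X that cV' unfolding U_def by (metis mult.commute order_trans)
        then show ?thesis by simp
      qed
      have X\<Omega>: "X y \<subseteq> ?\<Omega>" if "y \<in> e" for y using X that V'\<Omega> unfolding U_def by blast
      have fX: "finite (X y)" if "y \<in> e" for y using X that finU finite_subset by blast
      have "(\<Prod>v\<in>e. card (X v)) = card (X u) * card (X v)"
        unfolding 2(1) using 2(4) by simp
      also have "\<dots> \<le> 4 * count2 (\<lambda>x y. x \<noteq> y \<and> sylvester K x y = \<sigma>) (X u) (X v)"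
        using X\<Omega> large unfolding 2(1) by (intro dense2) (auto simp: \<sigma>_def)
      also have "count2 (\<lambda>x y. x \<noteq> y \<and> sylvester K x y = \<sigma>) (X u) (X v) \<le> card {z \<in> PiE {u, v} X. R e z}"
      proof (rule count2_le_card_PiE[OF 2(4)])
        fix x y assume xy: "x \<noteq> y \<and> sylvester K x y = \<sigma>"
        let ?f = "(\<lambda>_. undefined)(u := x, v := y)"
        have "sylvester K x y = - 1 \<longleftrightarrow> (u, v) \<in> parcs F" using xy unfolding \<sigma>_def by auto
        then show "R e ?f"
          unfolding R_def 2(1) using notri 2(1,4) xy symF[of u v] sylvester_commute[of K x y] by auto
      qed (use fX 2(1) in auto)
      finally show "(\<Prod>v\<in>e. card (X v)) \<le> 2 ^ 2 * card {z \<in> PiE e X. R e z}"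
        unfolding 2(1) by simp
    qed
  qed
  have "\<forall>e\<in>pattern F. \<exists>d. \<forall>X. (\<forall>v\<in>e. X v \<subseteq> U v \<and> card (U v) \<le> 2 ^ (E * (d + 1)) * card (X v)) \<longrightarrow>
      (\<Prod>v\<in>e. card (X v)) \<le> 2 ^ d * card {z \<in> PiE e X. R e z}"
    by (rule ballI) (rule ex)
  from bchoice[OF this]
  obtain D where D: "\<forall>e\<in>pattern F. \<forall>X. (\<forall>v\<in>e. X v \<subseteq> U v \<and> card (U v) \<le> 2 ^ (E * (D e + 1)) * card (X v))
      \<longrightarrow> (\<Prod>v\<in>e. card (X v)) \<le> 2 ^ D e * card {z \<in> PiE e X. R e z}"
    by (elim exE) (rule that)
  have loc: "\<forall>e\<in>pattern F. \<forall>x y. (\<forall>v\<in>e. x v = y v) \<longrightarrow> R e x = R e y"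
  proof (intro ballI allI impI)
    fix e and x y :: "'a \<Rightarrow> nat" assume xy: "\<forall>v\<in>e. x v = y v"
    then have "x ` e = y ` e" by (auto simp: image_def)
    then show "R e x = R e y" unfolding R_def using xy by auto
  qed
  have finC: "finite (pattern F)"
    by (rule finite_subset[of _ "Pow (pverts F)"]) (use pattern_subset finF in auto)
  have cardC: "card (pattern F) \<le> E" using card_pattern_le[OF finF lin] n(1) unfolding E_def by simp
  have subC: "\<forall>e\<in>pattern F. e \<subseteq> pverts F" using pattern_subset by blast
  have "(\<Prod>v\<in>pverts F. card (U v)) / 2 ^ (\<Sum>e\<in>pattern F. D e + 1) \<le> card (solutions (pverts F) U R (pattern F))"
    by (rule card_solutions_lower_bound[OF finF finU finC cardC linear_family_pattern[OF lin] subC loc D])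
  \<comment> \<open>A single solution suffices, so only positivity of the lower bound is
    used.\<close>
  moreover have "0 < (\<Prod>v\<in>pverts F. card (U v)) / (2::real) ^ (\<Sum>e\<in>pattern F. D e + 1)"
    unfolding U_def cV' by simp
  ultimately have "0 < card (solutions (pverts F) U R (pattern F))" by linarith
  then obtain x where "x \<in> solutions (pverts F) U R (pattern F)"
    by (metis card_gt_0_iff ex_in_conv)
  then have x: "x \<in> PiE (pverts F) U" "\<And>e. e \<in> pattern F \<Longrightarrow> R e x" unfolding solutions_def by auto
  show ?thesis
  proof (intro exI[of _ x] exI[of _ b] conjI ballI impI)
    show "x ` pverts F \<subseteq> ?\<Omega>" using x(1) V'\<Omega> unfolding U_def by fastforce
    fix u v assume uv: "u \<in> pverts F" "v \<in> pverts F" "u \<noteq> v"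
    then obtain e where "e \<in> pattern F" "u \<in> e" "v \<in> e" by (rule pattern_covers)
    then show "x u \<noteq> x v" "sylvester K (x u) (x v) = - 1 \<longleftrightarrow> (u, v) \<in> parcs F"
      using x(2)[of e] uv(3) unfolding R_def by blast+
  next
    fix T assume T: "T \<in> triangles F"
    then show "c (x ` T) = b" using x(2)[of T] unfolding R_def pattern_def by blast
  qed
qed

section \<open>The upper bound for the induced Ramsey number\<close>

theorem theorem1p1:
  fixes F :: "'a pair_pre_digraph" and n :: nat
  assumes "pair_graph F"
    and "card (pverts F) = n"
    and "linear_3graph (K3 F)"
  shows "R_ind_triangles F \<le> enat (2 ^ (2 ^ (2 ^ (40 * n))))"
proof -
  have "\<exists>G :: nat pair_pre_digraph. pair_graph G \<and> card (pverts G) \<le> 2 ^ 2 ^ 2 ^ (40 * n) \<and> ind_arrow_triangles G F"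
  proof (cases "n = 0")
    \<comment> \<open>The numerical estimate fails for \<open>n = 0\<close>, so an empty host is
      supplied directly.\<close>
    case True
    interpret F: pair_graph F by fact
    have empty: "pverts F = {}" using True assms(2) by simp
    define G :: "nat pair_pre_digraph" where "G = \<lparr>pverts = {}, parcs = {}\<rparr>"
    have G: "pair_graph G" by unfold_locales (auto simp: G_def symmetric_def sym_def)
    have "\<exists>H. induced_copy H F G \<and> (\<exists>b. \<forall>T\<in>triangles H. c T = b)" for c :: "nat set \<Rightarrow> bool"
    proof -
      let ?H = "\<lparr>pverts = (\<lambda>_. 0) ` pverts F, parcs = map_prod (\<lambda>_. 0) (\<lambda>_. 0) ` parcs F\<rparr>"
      have "induced_copy ?H F G"
        by (rule induced_copy_of_embedding(1)[OF assms(1) G]) (auto simp: empty)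
      moreover have "triangles ?H = {}" unfolding triangles_def by (auto simp: empty)
      ultimately show ?thesis by blast
    qed
    then have "ind_arrow_triangles G F" unfolding ind_arrow_triangles_def by blast
    then show ?thesis using G by (intro exI[of _ G]) (simp add: G_def)
  next
    case False
    define K :: nat where "K = 2 ^ 2 ^ (40 * n)"
    let ?G = "hadamard_graph K"
    have "\<exists>H. induced_copy H F ?G \<and> (\<exists>b. \<forall>T\<in>triangles H. c T = b)" for c :: "nat set \<Rightarrow> bool"
    proof -
      have "1 \<le> n" using False by simp
      from monochromatic_induced_embedding[OF assms(1,2) this assms(3) K_def, of c]
      obtain x b where x: "x ` pverts F \<subseteq> {..<2 ^ K}"
        and arcs: "\<forall>u\<in>pverts F. \<forall>v\<in>pverts F. u \<noteq> v \<longrightarrow>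
          x u \<noteq> x v \<and> (sylvester K (x u) (x v) = - 1 \<longleftrightarrow> (u, v) \<in> parcs F)"
        and mono: "\<forall>T\<in>triangles F. c (x ` T) = b"
        by (elim exE conjE) (rule that)
      let ?H = "\<lparr>pverts = x ` pverts F, parcs = map_prod x x ` parcs F\<rparr>"
      have inj: "inj_on x (pverts F)" using arcs unfolding inj_on_def by blast
      have sub: "x ` pverts F \<subseteq> pverts ?G" using x by (simp add: hadamard_graph_def)
      \<comment> \<open>The embedding speaks of distinct vertices only; absence of loops settles
        \<open>u = v\<close>.\<close>
      have loopfree: "(u, u) \<notin> parcs F" for u
        using assms(1) pair_loopfree_digraph.pair_no_loops[of F "(u, u)"]
        by (auto simp: pair_graph_def pair_digraph_def)
      have arcs': "(x u, x v) \<in> parcs ?G \<longleftrightarrow> (u, v) \<in> parcs F" if "u \<in> pverts F" "v \<in> pverts F" for u v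
        using arcs x that loopfree by (cases "u = v") (auto simp: hadamard_graph_def)
      have "induced_copy ?H F ?G"
        by (rule induced_copy_of_embedding(1)[OF assms(1) pair_graph_hadamard_graph inj sub arcs'])
      moreover have "c T = b" if "T \<in> triangles ?H" for T
      proof -
        have "\<exists>S\<in>triangles F. T = x ` S"
          by (rule induced_copy_of_embedding(2)[OF assms(1) pair_graph_hadamard_graph inj sub _ that]) (rule arcs')
        then show ?thesis using mono by blast
      qed
      ultimately show ?thesis by blast
    qed
    then have "ind_arrow_triangles ?G F" unfolding ind_arrow_triangles_def by blast
    moreover have "card (pverts ?G) \<le> 2 ^ 2 ^ 2 ^ (40 * n)" by (simp add: hadamard_graph_def K_def)
    ultimately show ?thesis using pair_graph_hadamard_graph by blast
  qed
  then obtain G :: "nat pair_pre_digraph" where G: "pair_graph G"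
    "card (pverts G) \<le> 2 ^ 2 ^ 2 ^ (40 * n)" "ind_arrow_triangles G F" by blast
  then have "R_ind_triangles F \<le> enat (card (pverts G))"
    unfolding R_ind_triangles_def by (intro Inf_lower) blast
  also have "\<dots> \<le> enat (2 ^ 2 ^ 2 ^ (40 * n))" using G(2) by simp
  finally show ?thesis .
qed

end
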